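(* (a) There is a function $\varepsilon(n)=o(n)$ such that with probability tending to $1$ as $n\to\infty$, $f^*(2,2,n)+\varepsilon(n)\ge \frac{49}{72}n$. (b) There is a function $\varepsilon(n)=o(n)$ such that with probability tending to $1$ as $n\to\infty$, $f^*(2,2,n)-\varepsilon(n)\le \frac34 n$.
   Context: A tournament is an orientation of a complete graph. An arborescence is an oriented tree with a designated root such that every vertex of the tree is reachable from the root by a directed path in the tree; its depth is the length of a longest directed path in it. An edge-colored arborescence is path-monochromatic if every directed path in it is monochromatic. For a tournament $T$, $f_T(2,2)$ is the largest integer $m$ such that every $2$-edge coloring of $T$ (arbitrary assignment of one of two colors to each edge) contains a path-monochromatic arborescence of depth at most $2$ with at least $m$ vertices. A random tournament $T\sim\mathcal T_n$ is the tournament on $[n]$ where each edge is oriented independently by a fair coin flip, and $f^*(2,2,n)$ denotes the random variable $f_T(2,2)$ for $T\sim\mathcal T_n$. *)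

theory Defs
  imports "HOL-Probability.Probability" "Graph_Theory.Digraph_Component"
begin

definition tournament :: "'a pair_pre_digraph \<Rightarrow> bool" where
  "tournament T \<longleftrightarrow> pair_digraph T \<and>
     (\<forall>u\<in>pverts T. \<forall>v\<in>pverts T. u \<noteq> v \<longrightarrow> ((u, v) \<in> parcs T) \<noteq> ((v, u) \<in> parcs T))"

text \<open>
  The library predicate \<^const>\<open>tree\<close> only excludes \<^emph>\<open>directed\<close> cycles, so it accepts digraphs whose
  underlying graph has a cycle. Here acyclicity refers to the underlying graph, given by
  \<^const>\<open>mk_symmetric\<close>; the bound on the length discards the closed walks that run along
  an edge and back.
\<close>
definition oriented_tree :: "'a pair_pre_digraph \<Rightarrow> bool" where
  "oriented_tree G \<longleftrightarrow> pair_digraph G \<and> antisym (parcs G) \<and>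
     Digraph_Component.connected (with_proj G) \<and>
     \<not> (\<exists>p. pre_digraph.cycle (with_proj (mk_symmetric (with_proj G))) p \<and> 3 \<le> length p)"

definition arborescence :: "'a pair_pre_digraph \<Rightarrow> 'a \<Rightarrow> bool" where
  "arborescence A r \<longleftrightarrow> oriented_tree A \<and> r \<in> pverts A \<and>
     (\<forall>v\<in>pverts A. \<exists>p. pre_digraph.apath (with_proj A) r p v)"

definition depth :: "'a pair_pre_digraph \<Rightarrow> nat" where
  "depth A = Max {length p | u p v. pre_digraph.apath (with_proj A) u p v}"

definition path_monochromatic :: "('a \<times> 'a \<Rightarrow> 'c) \<Rightarrow> 'a pair_pre_digraph \<Rightarrow> bool" where
  "path_monochromatic c A \<longleftrightarrow>
     (\<forall>u p v. pre_digraph.apath (with_proj A) u p v \<longrightarrow> (\<exists>k. \<forall>e\<in>set p. c e = k))"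

text \<open>
  The two colours are the elements of \<^typ>\<open>bool\<close>; the values of \<open>c\<close> outside the arcs of \<open>T\<close> are
  irrelevant. The maximum exists for every finite nonempty \<open>T\<close>.
\<close>
definition f22 :: "'a pair_pre_digraph \<Rightarrow> nat" where
  "f22 T = (GREATEST m. \<forall>c :: 'a \<times> 'a \<Rightarrow> bool. \<exists>A r.
     subgraph (with_proj A) (with_proj T) \<and> arborescence A r \<and> path_monochromatic c A \<and>
     depth A \<le> 2 \<and> m \<le> card (pverts A))"

definition edge_pairs :: "nat \<Rightarrow> (nat \<times> nat) set" where
  "edge_pairs n = {(i, j). 1 \<le> i \<and> i < j \<and> j \<le> n}"

definition orient :: "nat \<Rightarrow> (nat \<times> nat \<Rightarrow> bool) \<Rightarrow> nat pair_pre_digraph" where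
  "orient n b = \<lparr> pverts = {1..n},
     parcs = {e \<in> edge_pairs n. b e} \<union> prod.swap ` {e \<in> edge_pairs n. \<not> b e} \<rparr>"

definition random_tournament :: "nat \<Rightarrow> nat pair_pre_digraph pmf" where
  "random_tournament n =
     map_pmf (orient n) (Pi_pmf (edge_pairs n) False (\<lambda>_. bernoulli_pmf (1 / 2)))"

lemma finite_edge_pairs: "finite (edge_pairs n)"
  by (rule finite_subset[of _ "{1..n} \<times> {1..n}"]) (auto simp: edge_pairs_def)

lemma tournament_orient: "tournament (orient n b)"
proof -
  have "pair_digraph (orient n b)"
    using finite_edge_pairs[of n] by unfold_locales (auto simp: orient_def edge_pairs_def)
  moreover have "((u, v) \<in> parcs (orient n b)) \<noteq> ((v, u) \<in> parcs (orient n b))"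
    if "u \<in> {1..n}" "v \<in> {1..n}" "u \<noteq> v" for u v
    using that by (cases "u < v") (auto simp: orient_def edge_pairs_def image_iff)
  ultimately show ?thesis
    by (auto simp: tournament_def orient_def)
qed

lemma tournament_random_tournament: "T \<in> set_pmf (random_tournament n) \<Longrightarrow> tournament T"
  by (auto simp: random_tournament_def tournament_orient)

end

theory Submission
  imports Defs "HOL-Real_Asymp.Real_Asymp"
begin

text \<open>
  An arborescence as required, rooted at \<open>r\<close>, covers at most the vertices that \<open>r\<close> reaches by
  monochromatic paths of length at most 2, and can be made to cover all of them.

  Upper bound: colour an arc by whether it stays inside one half of a bisection of the vertices. The
  second arc of a monochromatic path of length 2 always leads back to the half of \<open>r\<close>, so \<open>r\<close>
  reaches only its own half and its out-neighbours in the other half, which are about \<open>n/4\<close> many.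

  Lower bound: call an arc \<open>w \<rightarrow> r\<close> bad if \<open>r\<close> does not reach \<open>w\<close>; then the other two arcs of every
  cyclic triangle through it have different colours. Hence a cyclic triangle has at most two bad
  arcs. Orient the 12 lines of the affine plane of order 3 cyclically; this gives a tournament on 9
  vertices whose 36 arcs split into 12 cyclic triangles, and for a suitable orientation not all
  12 can have two bad arcs. So at most 23 of the 36 arcs are bad in every copy of this tournament.
  In a quasirandom tournament every arc lies in about the same number of copies, in each of the 36
  roles, so at most about \<open>23/36 \<cdot> n\<^sup>2/2\<close> arcs are bad, and some root misses at most \<open>23/72 \<cdot> n\<close> vertices.
\<close>

section \<open>Common neighbourhoods in random tournaments\<close>

text \<open>Disjoint coin sets make the indicators \<open>Y x\<close> independent, each with mean
  \<open>1 / 2 ^ k\<close>, so Hoeffding's inequality for variables in \<open>[0, 1]\<close>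
  applies.\<close>

lemma pattern_count_concentration:
  fixes K :: "'a \<Rightarrow> 'e set" and g :: "'a \<Rightarrow> 'e \<Rightarrow> bool"
  assumes I: "finite I" and K: "\<And>x. x \<in> X \<Longrightarrow> K x \<subseteq> I" "\<And>x. x \<in> X \<Longrightarrow> card (K x) = k"
    and disj: "disjoint_family_on K X" and X: "finite X" "X \<noteq> {}" and t: "t \<ge> 0"
  shows "measure_pmf.prob (Pi_pmf I d (\<lambda>_. bernoulli_pmf (1 / 2)))
      {b. t \<le> \<bar>real (card {x \<in> X. \<forall>e\<in>K x. b e = g x e}) - real (card X) / 2 ^ k\<bar>}
    \<le> 2 * exp (- 2 * t\<^sup>2 / real (card X))"
proof -
  define M where "M = Pi_pmf I d (\<lambda>_. bernoulli_pmf (1 / 2))"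
  define Y :: "'a \<Rightarrow> ('e \<Rightarrow> bool) \<Rightarrow> real" where
    "Y x b = (if \<forall>e\<in>K x. b e = g x e then 1 else 0)" for x b
  \<comment> \<open>Independence passes from single coins to blocks for functions of the restriction
    of \<open>b\<close> to \<open>K x\<close>; \<open>Z x\<close> is \<open>Y x\<close> in that
    form.\<close>
  define Z :: "'a \<Rightarrow> ('e \<Rightarrow> bool) \<Rightarrow> real" where
    "Z x = indicator (PiE (K x) (\<lambda>e. {g x e}))" for x
  have ind: "prob_space.indep_vars (measure_pmf M) (\<lambda>_. count_space UNIV) (\<lambda>e b. b e) I"
    unfolding M_def by (rule indep_vars_Pi_pmf[OF I])
  have "prob_space.indep_vars (measure_pmf M) (\<lambda>_. borel) (\<lambda>x b. Z x (restrict (\<lambda>e. b e) (K x))) X"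
  proof (rule prob_space.indep_vars_compose2[OF measure_pmf.prob_space_axioms
        prob_space.indep_vars_restrict[OF measure_pmf.prob_space_axioms ind K(1) disj]])
    fix x assume x: "x \<in> X"
    show "Z x \<in> borel_measurable (PiM (K x) (\<lambda>_. count_space UNIV))"
      unfolding Z_def using finite_subset[OF K(1)[OF x] I]
      by (intro borel_measurable_indicator sets_PiM_I_finite) auto
  qed
  moreover have ZY: "Z x (restrict (\<lambda>e. b e) (K x)) = Y x b" for x b
    by (auto simp: Z_def Y_def indicator_def PiE_def Pi_def)
  ultimately have indY: "prob_space.indep_vars (measure_pmf M) (\<lambda>_. borel) Y X"
    by simp
  have expY: "measure_pmf.expectation M (Y x) = 1 / 2 ^ k" if x: "x \<in> X" for x
  proof -
    have fin: "finite (K x)" using finite_subset[OF K(1)[OF x] I] .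
    have "measure_pmf.expectation M (Y x) =
        measure_pmf.expectation M (indicator {b. \<forall>e\<in>K x. b e = g x e})"
      by (rule Bochner_Integration.integral_cong) (auto simp: Y_def indicator_def)
    also have "\<dots> = measure_pmf.prob M {b. \<forall>e\<in>K x. b e = g x e}"
      by simp
    \<comment> \<open>As a product set, unconstrained off \<open>K x\<close>, the event has a
      probability that factors over the coins.\<close>
    also have "{b. \<forall>e\<in>K x. b e = g x e} = Pi I (\<lambda>e. if e \<in> K x then {g x e} else UNIV)"
      using K(1)[OF x] by (auto simp: Pi_def split: if_splits)
    also have "measure_pmf.prob M \<dots> =
        (\<Prod>e\<in>I. measure_pmf.prob (bernoulli_pmf (1/2)) (if e \<in> K x then {g x e} else UNIV))"
      unfolding M_def by (rule measure_Pi_pmf_Pi[OF I])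
    also have "\<dots> = (\<Prod>e\<in>I. if e \<in> K x then 1 / 2 else 1)"
    proof (rule prod.cong[OF refl])
      fix e
      show "measure_pmf.prob (bernoulli_pmf (1/2)) (if e \<in> K x then {g x e} else UNIV) =
          (if e \<in> K x then 1 / 2 else 1 :: real)"
        by (cases "g x e") (auto simp: measure_pmf_single)
    qed
    also have "\<dots> = (\<Prod>e\<in>K x. 1 / 2)"
      using K(1)[OF x] I by (simp add: prod.If_cases Int_absorb1)
    also have "\<dots> = 1 / 2 ^ k"
      using K(2)[OF x] by (simp add: power_divide)
    finally show ?thesis .
  qed
  interpret H: Hoeffding_ineq M X Y "\<lambda>_. 0" "\<lambda>_. 1" "\<Sum>x\<in>X. measure_pmf.expectation M (Y x)"
    using X indY by unfold_locales (auto simp: Y_def)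
  have "measure_pmf.prob M {b \<in> space M. t \<le> \<bar>(\<Sum>x\<in>X. Y x b) -
        (\<Sum>x\<in>X. measure_pmf.expectation M (Y x))\<bar>}
      \<le> 2 * exp (- 2 * t\<^sup>2 / (\<Sum>x\<in>X. (1 - 0)\<^sup>2))"
    by (rule H.Hoeffding_ineq_abs_ge) (use X t in \<open>auto simp: card_gt_0_iff\<close>)
  moreover have "(\<Sum>x\<in>X. Y x b) = real (card {x \<in> X. \<forall>e\<in>K x. b e = g x e})" for b
    using X by (simp add: Y_def sum.If_cases Int_def)
  moreover have "(\<Sum>x\<in>X. measure_pmf.expectation M (Y x)) = real (card X) / 2 ^ k"
    by (simp add: expY)
  ultimately show ?thesis
    unfolding M_def[symmetric] by simp
qed

definition common_nbrs :: "'a pair_pre_digraph \<Rightarrow> 'a set \<Rightarrow> 'a set \<Rightarrow> 'a set \<Rightarrow> 'a set" where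
  "common_nbrs T X A B = {x \<in> X. (\<forall>a\<in>A. (a, x) \<in> parcs T) \<and> (\<forall>b\<in>B. (x, b) \<in> parcs T)}"

lemma arc_orient_iff:
  assumes "u \<in> {1..n}" "v \<in> {1..n}" "u \<noteq> v"
  shows "(u, v) \<in> parcs (orient n b) \<longleftrightarrow> b (min u v, max u v) = (u < v)"
  using assms by (cases "u < v") (auto simp: orient_def edge_pairs_def image_iff)

text \<open>The coins between \<open>x\<close> and \<open>A \<union> B\<close> decide whether
  \<open>x\<close> is counted, and different \<open>x\<close> use different coins because
  \<open>X\<close> avoids \<open>A \<union> B\<close>. The bound has \<open>n\<close> in place of
  \<open>card X\<close> so that it is uniform in a union bound.\<close>

lemma common_nbrs_concentration:
  assumes AB: "A \<inter> B = {}" "A \<union> B \<subseteq> {1..n}" and X: "X \<subseteq> {1..n} - (A \<union> B)" and t: "t \<ge> 0"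
  shows "measure_pmf.prob (random_tournament n)
      {T. t < \<bar>real (card (common_nbrs T X A B)) - real (card X) / 2 ^ card (A \<union> B)\<bar>}
    \<le> 2 * exp (- 2 * t\<^sup>2 / real n)"
proof (cases "X = {}")
  case True
  then show ?thesis using t by (simp add: common_nbrs_def)
next
  case False
  define K where "K x = (\<lambda>a. (min a x, max a x)) ` (A \<union> B)" for x
  \<comment> \<open>A coin shows \<open>True\<close> if the arc goes from the smaller to the larger
    number. So the coin of \<open>{a, x}\<close> must equal \<open>a < x\<close> for
    \<open>a \<in> A\<close> and its negation for \<open>a \<in> B\<close>; \<open>g\<close>
    recovers \<open>a\<close> as the end of \<open>e\<close> other than \<open>x\<close>.\<close>
  define g where "g x e = (let a = if fst e = x then snd e else fst e in a \<in> A \<longleftrightarrow> a < x)"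
    for x and e :: "nat \<times> nat"
  have fX: "finite X" using X finite_subset by blast
  have fAB: "finite (A \<union> B)" using AB finite_subset by blast
  have inj: "inj_on (\<lambda>a. (min a x, max a x)) (A \<union> B)" for x
    by (auto simp: inj_on_def min_def max_def split: if_splits)
  have common: "common_nbrs (orient n b) X A B = {x \<in> X. \<forall>e\<in>K x. b e = g x e}" for b
  proof -
    have "((\<forall>a\<in>A. (a, x) \<in> parcs (orient n b)) \<and> (\<forall>c\<in>B. (x, c) \<in> parcs (orient n b))) \<longleftrightarrow>
        (\<forall>e\<in>K x. b e = g x e)" if x: "x \<in> X" for x
    proof -
      have g: "g x (min a x, max a x) \<longleftrightarrow> (a \<in> A \<longleftrightarrow> a < x)" for a
        by (auto simp: g_def Let_def min_def max_def)
      have 1: "(a, x) \<in> parcs (orient n b) \<longleftrightarrow> b (min a x, max a x) = g x (min a x, max a x)"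
        if "a \<in> A" for a
      proof -
        have "a \<noteq> x" "a \<in> {1..n}" "x \<in> {1..n}" using that x X AB by auto
        then show ?thesis using arc_orient_iff[of a n x b] g[of a] that by auto
      qed
      have 2: "(x, a) \<in> parcs (orient n b) \<longleftrightarrow> b (min a x, max a x) = g x (min a x, max a x)"
        if "a \<in> B" for a
      proof -
        have "a \<notin> A" "a \<noteq> x" "a \<in> {1..n}" "x \<in> {1..n}" using that x X AB by auto
        then show ?thesis
          using arc_orient_iff[of x n a b] g[of a] by (auto simp: min.commute max.commute)
      qed
      show ?thesis using 1 2 by (auto simp: K_def)
    qed
    then show ?thesis by (auto simp: common_nbrs_def)
  qed
  have "measure_pmf.prob (random_tournament n)
      {T. t < \<bar>real (card (common_nbrs T X A B)) - real (card X) / 2 ^ card (A \<union> B)\<bar>}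
    = measure_pmf.prob (Pi_pmf (edge_pairs n) False (\<lambda>_. bernoulli_pmf (1 / 2)))
      {b. t < \<bar>real (card {x \<in> X. \<forall>e\<in>K x. b e = g x e}) - real (card X) / 2 ^ card (A \<union> B)\<bar>}"
    by (simp add: random_tournament_def vimage_def common)
  also have "\<dots> \<le> measure_pmf.prob (Pi_pmf (edge_pairs n) False (\<lambda>_. bernoulli_pmf (1 / 2)))
      {b. t \<le> \<bar>real (card {x \<in> X. \<forall>e\<in>K x. b e = g x e}) - real (card X) / 2 ^ card (A \<union> B)\<bar>}"
    by (rule measure_pmf.finite_measure_mono) auto
  also have "\<dots> \<le> 2 * exp (- 2 * t\<^sup>2 / real (card X))"
  proof (rule pattern_count_concentration[OF finite_edge_pairs])
    show "K x \<subseteq> edge_pairs n" if "x \<in> X" for x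
    proof
      fix e assume "e \<in> K x"
      then obtain a where a: "a \<in> A \<union> B" "e = (min a x, max a x)" by (auto simp: K_def)
      have "a \<in> {1..n}" "x \<in> {1..n}" "a \<noteq> x" using a(1) that X AB by auto
      then show "e \<in> edge_pairs n" by (auto simp: a(2) edge_pairs_def min_def max_def)
    qed
    show "card (K x) = card (A \<union> B)" for x
      unfolding K_def by (rule card_image[OF inj])
    show "disjoint_family_on K X"
      unfolding disjoint_family_on_def
    proof (intro ballI impI equals0I)
      fix x y e assume xy: "x \<in> X" "y \<in> X" "x \<noteq> y" and e: "e \<in> K x \<inter> K y"
      \<comment> \<open>A common coin gives \<open>{a, x} = {a', y}\<close> with
        \<open>x \<noteq> y\<close>, which would put \<open>x\<close> into
        \<open>A \<union> B\<close>.\<close>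
      have ends: "\<exists>a\<in>A \<union> B. {fst e, snd e} = {a, z}" if "e \<in> K z" for z
        using that by (auto simp: K_def min_def max_def)
      obtain a a' where "a \<in> A \<union> B" "a' \<in> A \<union> B" "{a, x} = {a', y}"
        using ends[of x] ends[of y] e by (metis IntE)
      then have "x \<in> A \<union> B" using xy by (auto simp: doubleton_eq_iff)
      then show False using xy X by auto
    qed
  qed (use fX False t in auto)
  also have "\<dots> \<le> 2 * exp (- 2 * t\<^sup>2 / real n)"
  proof -
    have "card X \<le> n" using card_mono[of "{1..n}" X] X by auto
    moreover have "card X > 0" using fX False by (simp add: card_gt_0_iff)
    ultimately show ?thesis by (simp add: frac_le)
  qed
  finally show ?thesis .
qed

text \<open>Such a set consists of the \<open>Some\<close> entries of a list of length
  \<open>k\<close> padded with \<open>None\<close>, and each entry has \<open>card V + 1\<close>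
  possible values.\<close>

lemma card_small_subsets_le:
  assumes "finite V"
  shows "card {A. A \<subseteq> V \<and> card A \<le> k} \<le> (card V + 1) ^ k"
proof -
  let ?L = "{xs. set xs \<subseteq> insert None (Some ` V) \<and> length xs = k}"
  have fin: "finite (insert None (Some ` V))" using assms by simp
  have "{A. A \<subseteq> V \<and> card A \<le> k} \<subseteq> (\<lambda>xs. {a. Some a \<in> set xs}) ` ?L"
  proof safe
    fix A assume A: "A \<subseteq> V" "card A \<le> k"
    then obtain ys where ys: "set ys = A" "distinct ys"
      using finite_distinct_list[of A] finite_subset assms by blast
    let ?xs = "map Some ys @ replicate (k - length ys) None"
    have "length ys \<le> k" using ys A distinct_card by metis
    then have "?xs \<in> ?L" using A ys by auto
    moreover have "A = {a. Some a \<in> set ?xs}" using ys by auto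
    ultimately show "A \<in> (\<lambda>xs. {a. Some a \<in> set xs}) ` ?L" by blast
  qed
  then have "card {A. A \<subseteq> V \<and> card A \<le> k} \<le> card ?L"
    using finite_lists_length_eq[OF fin] by (meson card_image_le card_mono finite_imageI le_trans)
  also have "\<dots> = card (insert None (Some ` V)) ^ k"
    by (rule card_lists_length_eq[OF fin])
  also have "card (insert None (Some ` V)) = card V + 1"
    using assms by (simp add: card_image)
  finally show ?thesis .
qed

text \<open>The test set \<open>X\<close> may vary with \<open>A\<close> and \<open>B\<close>: the
  lower bound takes all remaining vertices, the upper bound the half that avoids a given
  vertex.\<close>

definition quasirandom ::
  "nat \<Rightarrow> (nat set \<Rightarrow> nat set \<Rightarrow> nat set) \<Rightarrow> nat \<Rightarrow> real \<Rightarrow> nat pair_pre_digraph \<Rightarrow> bool" where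
  "quasirandom k X n t T \<longleftrightarrow> (\<forall>A B. A \<inter> B = {} \<longrightarrow> A \<union> B \<subseteq> {1..n} \<longrightarrow> card (A \<union> B) \<le> k \<longrightarrow>
     \<bar>real (card (common_nbrs T (X A B) A B)) - real (card (X A B)) / 2 ^ card (A \<union> B)\<bar> \<le> t)"

text \<open>Union bound over the pairs \<open>(A, B)\<close>: both sets have at most
  \<open>k\<close> elements, so there are at most \<open>(n + 1) ^ (2 * k)\<close> pairs.\<close>

lemma prob_quasirandom:
  assumes X: "\<And>A B. X A B \<subseteq> {1..n} - (A \<union> B)" and t: "t \<ge> 0"
  shows "1 - measure_pmf.prob (random_tournament n) {T. quasirandom k X n t T}
    \<le> 2 * (real n + 1) ^ (2 * k) * exp (- 2 * t\<^sup>2 / real n)"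
proof -
  let ?S = "{A. A \<subseteq> {1..n} \<and> card A \<le> k}"
  let ?P = "{(A, B). A \<inter> B = {} \<and> A \<union> B \<subseteq> {1..n} \<and> card (A \<union> B) \<le> k}"
  let ?bad = "\<lambda>(A, B). {T. t < \<bar>real (card (common_nbrs T (X A B) A B))
                - real (card (X A B)) / 2 ^ card (A \<union> B)\<bar>}"
  have P: "?P \<subseteq> ?S \<times> ?S"
  proof safe
    fix A B :: "nat set" assume *: "A \<union> B \<subseteq> {1..n}" "card (A \<union> B) \<le> k"
    then have "finite (A \<union> B)" using finite_subset by blast
    then have "card A \<le> card (A \<union> B)" "card B \<le> card (A \<union> B)" by (auto intro: card_mono)
    then show "card A \<le> k" "card B \<le> k" using * by auto
  qed auto
  have fS: "finite ?S" by simp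
  have fP: "finite ?P" using P fS by (meson finite_SigmaI finite_subset)
  have "card ?P \<le> card (?S \<times> ?S)" by (rule card_mono[OF _ P]) (use fS in auto)
  also have "\<dots> \<le> (n + 1) ^ k * (n + 1) ^ k"
    unfolding card_cartesian_product
    using card_small_subsets_le[of "{1..n}" k] by (intro mult_mono) auto
  also have "\<dots> = (n + 1) ^ (2 * k)" by (simp add: mult_2 power_add)
  finally have cP: "real (card ?P) \<le> (real n + 1) ^ (2 * k)"
    using of_nat_mono[of "card ?P" "(n + 1) ^ (2 * k)", where 'a = real] by (simp add: add.commute)
  have "1 - measure_pmf.prob (random_tournament n) {T. quasirandom k X n t T}
      = measure_pmf.prob (random_tournament n) (UNIV - {T. quasirandom k X n t T})"
    using measure_pmf.prob_compl[of "{T. quasirandom k X n t T}" "random_tournament n"] by simp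
  also have "\<dots> \<le> measure_pmf.prob (random_tournament n) (\<Union>p\<in>?P. ?bad p)"
  proof (rule measure_pmf.finite_measure_mono)
    show "UNIV - {T. quasirandom k X n t T} \<subseteq> (\<Union>p\<in>?P. ?bad p)"
    proof
      fix T assume "T \<in> UNIV - {T. quasirandom k X n t T}"
      then obtain A B where "A \<inter> B = {}" "A \<union> B \<subseteq> {1..n}" "card (A \<union> B) \<le> k"
        "t < \<bar>real (card (common_nbrs T (X A B) A B)) - real (card (X A B)) / 2 ^ card (A \<union> B)\<bar>"
        unfolding quasirandom_def by (simp add: not_le) blast
      then have "(A, B) \<in> ?P" "T \<in> ?bad (A, B)" by simp_all
      then show "T \<in> (\<Union>p\<in>?P. ?bad p)" by (rule UN_I)
    qed
  qed simp
  also have "\<dots>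
      \<le> (\<Sum>p\<in>?P. measure_pmf.prob (random_tournament n) (?bad p))"
    by (rule measure_pmf.finite_measure_subadditive_finite[OF fP]) auto
  also have "\<dots> \<le> (\<Sum>p\<in>?P. 2 * exp (- 2 * t\<^sup>2 / real n))"
  proof (rule sum_mono)
    fix p assume "p \<in> ?P"
    then obtain A B where "p = (A, B)" "A \<inter> B = {}" "A \<union> B \<subseteq> {1..n}" by auto
    then show "measure_pmf.prob (random_tournament n) (?bad p) \<le> 2 * exp (- 2 * t\<^sup>2 / real n)"
      using common_nbrs_concentration[OF _ _ X t] by simp
  qed
  also have "\<dots> = real (card ?P) * (2 * exp (- 2 * t\<^sup>2 / real n))" by simp
  also have "\<dots> \<le> (real n + 1) ^ (2 * k) * (2 * exp (- 2 * t\<^sup>2 / real n))"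
    by (rule mult_right_mono[OF cP]) simp
  finally show ?thesis by (simp add: mult_ac)
qed

text \<open>The deviation \<open>n powr (3 / 4)\<close> is \<open>o(n)\<close>, yet its square
  divided by \<open>n\<close> is the square root of \<open>n\<close>, so the exponential beats the
  polynomial number of pairs. The size 8 serves to place the ninth vertex of a 9-vertex tournament
  after the other eight.\<close>

lemma quasirandom_whp:
  assumes X: "\<And>n A B. X n A B \<subseteq> {1..n} - (A \<union> B)"
  shows "(\<lambda>n. measure_pmf.prob (random_tournament n)
    {T. quasirandom 8 (X n) n (real n powr (3 / 4)) T}) \<longlonglongrightarrow> 1"
proof -
  let ?p = "\<lambda>n. measure_pmf.prob (random_tournament n)
    {T. quasirandom 8 (X n) n (real n powr (3 / 4)) T}"
  let ?q = "\<lambda>n. 1 - 2 * (real n + 1) ^ 16 * exp (- 2 * (real n powr (3 / 4))\<^sup>2 / real n)"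
  have "?q \<longlonglongrightarrow> 1" by real_asymp
  moreover have "?q n \<le> ?p n" for n
    using prob_quasirandom[of "X n" n "real n powr (3 / 4)" 8] X by simp
  moreover have "?p n \<le> 1" for n by simp
  ultimately show ?thesis
    by (intro tendsto_sandwich[of ?q ?p sequentially "\<lambda>_. 1"]) auto
qed

section \<open>Arborescences of depth 2\<close>

lemma apath_with_projD:
  assumes "pre_digraph.apath (with_proj G) u p v"
  shows "u \<in> pverts G" "set p \<subseteq> parcs G" "pcas u p v"
  using assms
  by (simp_all add: pre_digraph.apath_def pre_digraph.awalk_def cas_with_proj_eq)

lemma pcas_consecutive:
  assumes "pcas u p v" "p \<noteq> []"
  shows "fst (hd p) = u" "snd (last p) = v" "Suc i < length p \<Longrightarrow> fst (p ! Suc i) = snd (p ! i)"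
  using assms
proof (induction p arbitrary: u i)
  case (Cons e p)
  { case 1 then show ?case by simp }
  { case 2 then show ?case using Cons.IH(2)[of "snd e"] by auto }
  { case 3
    show ?case
    proof (cases i)
      case 0
      then show ?thesis using 3 Cons.IH(1)[of "snd e"] by (cases p) auto
    next
      case (Suc j)
      then show ?thesis using 3 Cons.IH(3)[where i = j and u = "snd e"] by (cases p) auto
    qed }
qed simp_all

lemma tl_pawalk_verts: "pcas u p v \<Longrightarrow> tl (pawalk_verts u p) = map snd p"
proof (induction p arbitrary: u)
  case (Cons e p)
  then show ?case by (cases p) auto
qed simp

text \<open>The rank is the depth up to an additive constant; it excludes cycles of the parent function.\<close>
locale parent_tree =
  fixes R :: "'a set" and r :: 'a and par :: "'a \<Rightarrow> 'a" and rank :: "'a \<Rightarrow> nat"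
  assumes finite_R: "finite R" and root: "r \<in> R"
    and par: "v \<in> R \<Longrightarrow> v \<noteq> r \<Longrightarrow> par v \<in> R"
    and rank_par: "v \<in> R \<Longrightarrow> v \<noteq> r \<Longrightarrow> rank v = Suc (rank (par v))"
begin

definition tree :: "'a pair_pre_digraph" where
  "tree = \<lparr>pverts = R, parcs = {(par v, v) | v. v \<in> R \<and> v \<noteq> r}\<rparr>"

lemma pverts_tree [simp]: "pverts tree = R"
  by (simp add: tree_def)

lemma arc_tree_iff: "(u, v) \<in> parcs tree \<longleftrightarrow> v \<in> R \<and> v \<noteq> r \<and> u = par v"
  by (auto simp: tree_def)

lemma rank_arc: "(u, v) \<in> parcs tree \<Longrightarrow> rank v = Suc (rank u)"
  using rank_par by (auto simp: arc_tree_iff)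

lemma pair_digraph_tree: "pair_digraph tree"
proof
  have "parcs tree = (\<lambda>v. (par v, v)) ` (R - {r})" by (auto simp: tree_def)
  then show "finite (parcs tree)" using finite_R by simp
  show "fst e \<noteq> snd e" if "e \<in> parcs tree" for e
    using rank_arc[of "fst e" "snd e"] that by auto
qed (use finite_R par in \<open>auto simp: tree_def\<close>)

sublocale T: pair_digraph tree by (rule pair_digraph_tree)

lemma root_reachable:
  assumes "v \<in> R"
  shows "r \<rightarrow>\<^sup>*\<^bsub>with_proj tree\<^esub> v"
  using assms
proof (induction "rank v" arbitrary: v rule: less_induct)
  case less
  show ?case
  proof (cases "v = r")
    case True
    then show ?thesis using root by auto
  next
    case False
    then have "r \<rightarrow>\<^sup>*\<^bsub>with_proj tree\<^esub> par v"
      using less par rank_par by simp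
    moreover have "(par v, v) \<in> parcs tree" using False less by (simp add: arc_tree_iff)
    ultimately show ?thesis by (auto intro: T.reachable_adj_trans)
  qed
qed

lemma connected_tree: "Digraph_Component.connected (with_proj tree)"
  unfolding Digraph_Component.connected_def
proof
  interpret S: pair_wf_digraph "mk_symmetric (with_proj tree)" ..
  fix u v assume "u \<in> verts (with_proj (mk_symmetric (with_proj tree)))"
    and "v \<in> verts (with_proj (mk_symmetric (with_proj tree)))"
  then have r: "r \<rightarrow>\<^sup>*\<^bsub>with_proj (mk_symmetric (with_proj tree))\<^esub> u"
      "r \<rightarrow>\<^sup>*\<^bsub>with_proj (mk_symmetric (with_proj tree))\<^esub> v"
    by (auto intro!: T.reachable_mk_symmetricI root_reachable)
  have "u \<rightarrow>\<^sup>*\<^bsub>with_proj (mk_symmetric (with_proj tree))\<^esub> r"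
    using symmetric_reachable[OF symmetric_mk_symmetric r(1)] .
  then show "u \<rightarrow>\<^sup>*\<^bsub>with_proj (mk_symmetric (with_proj tree))\<^esub> v"
    using r(2) by (rule S.reachable_trans)
qed (use root in auto)

text \<open>Both neighbours on a cycle of a vertex of maximal rank would be its parent.\<close>
lemma no_cycle:
  assumes cyc: "pre_digraph.cycle (with_proj (mk_symmetric (with_proj tree))) p"
  shows "length p < 3"
proof (rule ccontr)
  assume len: "\<not> length p < 3"
  obtain u where u: "set p \<subseteq> parcs (mk_symmetric (with_proj tree))" "pcas u p u"
      "distinct (tl (pawalk_verts u p))" "p \<noteq> []"
    using cyc by (auto simp: pre_digraph.cycle_def pre_digraph.awalk_def cas_with_proj_eq
        awalk_verts_with_proj_eq)
  have dist: "distinct (map snd p)"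
    using u(3) tl_pawalk_verts[OF u(2)] by simp
  note consec = pcas_consecutive[OF u(2) u(4)]
  have "Max (rank ` snd ` set p) \<in> rank ` snd ` set p"
    using u(4) by (intro Max_in) auto
  then obtain i where i: "i < length p" "rank (snd (p ! i)) = Max (rank ` snd ` set p)"
    by (auto simp: in_set_conv_nth)
  define v where "v = snd (p ! i)"
  have max: "rank (snd (p ! j)) \<le> rank v" if "j < length p" for j
    using that i by (auto simp: v_def intro!: Max_ge)
  \<comment> \<open>In cyclic order \<open>p ! j\<close> precedes and \<open>p ! k\<close> follows
    the arc \<open>p ! i\<close> into \<open>v\<close>, and length at least 3 keeps them apart.
    Their heads are the two neighbours of \<open>v\<close>; both being \<open>par v\<close>
    contradicts \<open>dist\<close>.\<close>
  define j where "j = (if i = 0 then length p - 1 else i - 1)"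
  define k where "k = (if Suc i = length p then 0 else Suc i)"
  have jk: "j < length p" "k < length p" "j \<noteq> k" using i len by (auto simp: j_def k_def)
  have pj: "snd (p ! j) = fst (p ! i)"
    using consec(1,2) consec(3)[of "i - 1"] i u(4)
    by (auto simp: j_def hd_conv_nth last_conv_nth)
  have pk: "fst (p ! k) = v"
  proof (cases "Suc i = length p")
    case True
    then have "i = length p - 1" by simp
    then show ?thesis
      using consec(1,2) u(4) True by (simp add: k_def v_def hd_conv_nth last_conv_nth)
  next
    case False
    then show ?thesis using consec(3)[of i] i by (simp add: k_def v_def)
  qed
  have parent: "w = par v"
    if "(w, v) \<in> parcs (mk_symmetric (with_proj tree)) \<or> (v, w) \<in> parcs (mk_symmetric (with_proj tree))"
      "rank w \<le> rank v" for w
  proof -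
    have "(w, v) \<in> parcs tree \<or> (v, w) \<in> parcs tree"
      using that(1) by (auto simp: parcs_mk_symmetric)
    then show ?thesis using rank_arc[of v w] that(2) by (auto simp: arc_tree_iff)
  qed
  have "p ! i = (snd (p ! j), v)" by (simp add: pj v_def)
  then have "(snd (p ! j), v) \<in> parcs (mk_symmetric (with_proj tree))"
    using u(1) i(1) by (metis nth_mem subsetD)
  then have "snd (p ! j) = par v" using parent max[OF jk(1)] by blast
  moreover have "p ! k = (v, snd (p ! k))" using pk by (metis prod.collapse)
  then have "(v, snd (p ! k)) \<in> parcs (mk_symmetric (with_proj tree))"
    using u(1) jk(2) by (metis nth_mem subsetD)
  then have "snd (p ! k) = par v" using parent max[OF jk(2)] by blast
  ultimately show False
    using nth_eq_iff_index_eq[OF dist, of j k] jk by simp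
qed

lemma arborescence_tree: "arborescence tree r"
proof -
  have "antisym (parcs tree)"
  proof (rule antisymI)
    fix u v assume "(u, v) \<in> parcs tree" "(v, u) \<in> parcs tree"
    then show "u = v" using rank_arc[of u v] rank_arc[of v u] by simp
  qed
  then have "oriented_tree tree"
    using pair_digraph_tree connected_tree no_cycle unfolding oriented_tree_def by (meson not_le)
  moreover have "\<exists>p. T.apath r p v" if "v \<in> R" for v
    using root_reachable[OF that] by (simp only: T.reachable_apath)
  ultimately show ?thesis
    using root unfolding arborescence_def by auto
qed

text \<open>Every arc raises the rank by one, so path lengths are rank differences; ranks up to 2
  then bound the depth by 2.\<close>

lemma rank_apath:
  assumes "pre_digraph.apath (with_proj tree) u p v"
  shows "rank v = rank u + length p"
  using apath_with_projD(2,3)[OF assms]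
proof (induction p arbitrary: u)
  case (Cons e p)
  then have "(u, snd e) \<in> parcs tree" by auto
  then show ?case using rank_arc[of u "snd e"] Cons.IH[of "snd e"] Cons.prems by simp
qed simp

end

section \<open>Monochromatic reach of a root and the value of \<open>f22\<close>\<close>

definition mono_reach :: "'a pair_pre_digraph \<Rightarrow> ('a \<times> 'a \<Rightarrow> bool) \<Rightarrow> 'a \<Rightarrow> 'a set" where
  "mono_reach T c r = {v \<in> pverts T. v = r \<or> (r, v) \<in> parcs T \<or>
     (\<exists>x. (r, x) \<in> parcs T \<and> (x, v) \<in> parcs T \<and> c (r, x) = c (x, v))}"

text \<open>The tree path from \<open>r\<close> to a vertex is no longer than the depth, is
  monochromatic, and is also a path of \<open>T\<close>.\<close>

lemma pverts_arborescence_subset_mono_reach: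
  assumes T: "subgraph (with_proj A) (with_proj T)" and A: "arborescence A r"
    and c: "path_monochromatic c A" and depth: "depth A \<le> 2"
  shows "pverts A \<subseteq> mono_reach T c r"
proof
  fix v assume v: "v \<in> pverts A"
  interpret A: pair_digraph A
    using A by (simp add: arborescence_def oriented_tree_def)
  obtain p where p: "A.apath r p v"
    using A v by (auto simp: arborescence_def)
  \<comment> \<open>\<open>Max\<close> bounds its members only for a finite set; the lengths are an
    image of the finite set of path triples.\<close>
  have "{length p | u p v. A.apath u p v} = (\<lambda>x. length (fst (snd x))) ` {(u, p, v). A.apath u p v}"
    by force
  then have "finite {length p | u p v. A.apath u p v}"
    using A.apaths_finite_triple by simp
  then have "length p \<le> depth A"
    unfolding depth_def using p by (intro Max_ge) auto
  then have len: "length p \<le> 2" using depth by simp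
  have sub: "pverts A \<subseteq> pverts T" "parcs A \<subseteq> parcs T"
    using T by (auto simp: subgraph_def)
  obtain k where k: "\<forall>e\<in>set p. c e = k"
    using c[unfolded path_monochromatic_def, rule_format, OF p] by blast
  note path = apath_with_projD[OF p]
  show "v \<in> mono_reach T c r"
  proof (cases p)
    case Nil
    then show ?thesis using path v sub by (auto simp: mono_reach_def)
  next
    case (Cons e q)
    show ?thesis
    proof (cases q)
      case Nil
      then have "(r, v) = e" using path Cons by (auto simp: prod_eq_iff)
      then have "(r, v) \<in> parcs T" using path Cons sub by auto
      then show ?thesis using v sub by (auto simp: mono_reach_def)
    next
      case (Cons f q')
      then have "p = [e, f]" using len \<open>p = e # q\<close> by simp
      then have ef: "e = (r, snd e)" "f = (snd e, v)" "e \<in> parcs T" "f \<in> parcs T" "c e = c f"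
        using path sub k by (auto simp: prod_eq_iff)
      then have "(r, snd e) \<in> parcs T \<and> (snd e, v) \<in> parcs T \<and> c (r, snd e) = c (snd e, v)"
        by metis
      then show ?thesis using v sub by (auto simp: mono_reach_def)
    qed
  qed
qed

text \<open>Hang the out-neighbours of \<open>r\<close> on \<open>r\<close>, and every other vertex
  on a middle vertex of a monochromatic path of length 2. The middle vertices are out-neighbours of
  \<open>r\<close>, so ranks 0, 1 and 2 suffice.\<close>

lemma arborescence_on_mono_reach:
  assumes T: "pair_digraph T" and r: "r \<in> pverts T"
  obtains A where "subgraph (with_proj A) (with_proj T)" "arborescence A r"
    "path_monochromatic c A" "depth A \<le> 2" "pverts A = mono_reach T c r"
proof -
  interpret T: pair_digraph T by (rule T)
  define R where "R = mono_reach T c r"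
  define mid where "mid v = (SOME x. (r, x) \<in> parcs T \<and> (x, v) \<in> parcs T \<and> c (r, x) = c (x, v))" for v
  define par where "par v = (if (r, v) \<in> parcs T then r else mid v)" for v
  define rank :: "'a \<Rightarrow> nat" where
    "rank v = (if v = r then 0 else if (r, v) \<in> parcs T then 1 else 2)" for v
  have mid: "(r, mid v) \<in> parcs T \<and> (mid v, v) \<in> parcs T \<and> c (r, mid v) = c (mid v, v)"
    if "v \<in> R" "v \<noteq> r" "(r, v) \<notin> parcs T" for v
  proof -
    have "\<exists>x. (r, x) \<in> parcs T \<and> (x, v) \<in> parcs T \<and> c (r, x) = c (x, v)"
      using that by (auto simp: R_def mono_reach_def)
    then show ?thesis unfolding mid_def by (rule someI_ex)
  qed
  have no_loop: "(r, r) \<notin> parcs T" using T.pair_no_loops by fastforce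
  have nbr: "x \<in> R \<and> x \<noteq> r" if "(r, x) \<in> parcs T" for x
    using that no_loop T.in_arcsD2 by (auto simp: R_def mono_reach_def)
  have rR: "r \<in> R" using r by (simp add: R_def mono_reach_def)
  interpret P: parent_tree R r par rank
  proof
    show "finite R"
      using T.pair_finite_verts by (auto simp: R_def mono_reach_def intro: finite_subset)
    fix v assume v: "v \<in> R" "v \<noteq> r"
    show "par v \<in> R" using mid[OF v] nbr rR by (auto simp: par_def)
    show "rank v = Suc (rank (par v))" using mid[OF v] nbr v by (auto simp: par_def rank_def)
  qed (rule rR)
  have arcs: "parcs P.tree \<subseteq> parcs T"
  proof safe
    fix u v assume "(u, v) \<in> parcs P.tree"
    then show "(u, v) \<in> parcs T" using mid[of v] by (auto simp: P.arc_tree_iff par_def)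
  qed
  have verts: "pverts P.tree \<subseteq> pverts T"
    unfolding P.pverts_tree by (auto simp: R_def mono_reach_def)
  have sub: "subgraph (with_proj P.tree) (with_proj T)"
    using arcs verts P.T.wf_digraph_axioms T.wf_digraph_axioms by (auto simp: subgraph_def)
  have len: "length p \<le> 2" if "pre_digraph.apath (with_proj P.tree) u p v" for u p v
    using P.rank_apath[OF that] by (simp add: rank_def split: if_splits)
  have depth: "depth P.tree \<le> 2"
    unfolding depth_def
  proof (rule Max.boundedI)
    have "{length p | u p v. pre_digraph.apath (with_proj P.tree) u p v} \<subseteq> {..2}" using len by auto
    then show "finite {length p | u p v. pre_digraph.apath (with_proj P.tree) u p v}"
      using finite_subset by blast
    have "P.T.apath r [] r" using rR by (simp add: P.T.apath_Nil_iff)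
    then show "{length p | u p v. pre_digraph.apath (with_proj P.tree) u p v} \<noteq> {}" by blast
  qed (use len in auto)
  have mono: "path_monochromatic c P.tree"
    unfolding path_monochromatic_def
  proof (intro allI impI)
    fix u p v assume p: "pre_digraph.apath (with_proj P.tree) u p v"
    note path = apath_with_projD[OF p]
    consider "p = []" | e where "p = [e]" | e f where "p = [e, f]"
      using len[OF p] by (cases p rule: remdups_adj.cases) auto
    then show "\<exists>k. \<forall>e\<in>set p. c e = k"
    proof cases
      case (3 e f)
      \<comment> \<open>Ranks lie between 0 and 2, so a path with two arcs starts at the root and
        ends at a vertex attached to its \<open>mid\<close>.\<close>
      then have "rank v = 2" "rank u = 0"
        using P.rank_apath[OF p] by (auto simp: rank_def split: if_splits)
      then have u: "u = r" and v: "v \<noteq> r" "(r, v) \<notin> parcs T"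
        by (auto simp: rank_def split: if_splits)
      have e: "e = (r, snd e)" and f: "f = (snd e, v)" and "f \<in> parcs P.tree"
        using path 3 u by (auto simp: prod_eq_iff)
      then have "(snd e, v) \<in> parcs P.tree" by simp
      then have "v \<in> R" "snd e = mid v" using v by (auto simp: P.arc_tree_iff par_def)
      then have "c e = c f" using mid[of v] v e f by metis
      then show ?thesis using 3 by auto
    qed auto
  qed
  have "pverts P.tree = mono_reach T c r"
    unfolding P.pverts_tree by (rule R_def)
  then show ?thesis
    by (rule that[OF sub P.arborescence_tree mono depth])
qed

text \<open>Admissible values are bounded by the number of vertices, so \<open>GREATEST\<close>
  dominates each of them; a tree filling \<open>mono_reach T c r\<close> shows that \<open>m\<close>
  is admissible.\<close>

lemma f22_ge:
  assumes T: "pair_digraph T" and m: "\<And>c. \<exists>r\<in>pverts T. m \<le> card (mono_reach T c r)"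
  shows "m \<le> f22 T"
  unfolding f22_def
proof (rule Greatest_le_nat)
  show "\<forall>c :: 'a \<times> 'a \<Rightarrow> bool. \<exists>A r. subgraph (with_proj A) (with_proj T) \<and> arborescence A r \<and>
      path_monochromatic c A \<and> depth A \<le> 2 \<and> m \<le> card (pverts A)"
  proof
    fix c :: "'a \<times> 'a \<Rightarrow> bool"
    obtain r where r: "r \<in> pverts T" "m \<le> card (mono_reach T c r)" using m by blast
    obtain A where "subgraph (with_proj A) (with_proj T)" "arborescence A r"
        "path_monochromatic c A" "depth A \<le> 2" "pverts A = mono_reach T c r"
      using arborescence_on_mono_reach[OF T r(1)] .
    then show "\<exists>A r. subgraph (with_proj A) (with_proj T) \<and> arborescence A r \<and>
        path_monochromatic c A \<and> depth A \<le> 2 \<and> m \<le> card (pverts A)"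
      using r(2) by (intro exI[of _ A] exI[of _ r]) simp
  qed
  fix k assume "\<forall>c :: 'a \<times> 'a \<Rightarrow> bool. \<exists>A r. subgraph (with_proj A) (with_proj T) \<and> arborescence A r \<and>
      path_monochromatic c A \<and> depth A \<le> 2 \<and> k \<le> card (pverts A)"
  then obtain A where "subgraph (with_proj A) (with_proj T)" "k \<le> card (pverts A)" by blast
  moreover have "finite (pverts T)"
    using T by (simp add: pair_digraph_def pair_fin_digraph_def pair_fin_digraph_axioms_def)
  ultimately show "k \<le> card (pverts T)"
    using card_mono[of "pverts T" "pverts A"] by (simp add: subgraph_def)
qed

text \<open>The value \<open>f22 T\<close> is itself admissible, so the colouring \<open>c\<close>
  has an arborescence of that size, and it lies inside \<open>mono_reach T c r\<close> for its root
  \<open>r\<close>.\<close>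

lemma f22_le:
  assumes T: "pair_digraph T" "pverts T \<noteq> {}"
    and M: "\<And>r. r \<in> pverts T \<Longrightarrow> card (mono_reach T c r) \<le> M"
  shows "f22 T \<le> M"
proof -
  let ?P = "\<lambda>m. \<forall>c :: 'a \<times> 'a \<Rightarrow> bool. \<exists>A r. subgraph (with_proj A) (with_proj T) \<and> arborescence A r \<and>
      path_monochromatic c A \<and> depth A \<le> 2 \<and> m \<le> card (pverts A)"
  have fin: "finite (pverts T)"
    using T by (simp add: pair_digraph_def pair_fin_digraph_def pair_fin_digraph_axioms_def)
  obtain r where "r \<in> pverts T" using T by auto
  \<comment> \<open>\<open>GREATEST\<close> is attained only if some value is admissible; 0 is,
    because \<open>T\<close> has a vertex to serve as root.\<close>
  have "?P 0"
  proof
    fix c :: "'a \<times> 'a \<Rightarrow> bool"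
    obtain A where "subgraph (with_proj A) (with_proj T)" "arborescence A r"
        "path_monochromatic c A" "depth A \<le> 2" "pverts A = mono_reach T c r"
      using arborescence_on_mono_reach[OF T(1) \<open>r \<in> pverts T\<close>] .
    then show "\<exists>A r. subgraph (with_proj A) (with_proj T) \<and> arborescence A r \<and>
        path_monochromatic c A \<and> depth A \<le> 2 \<and> 0 \<le> card (pverts A)"
      by (intro exI[of _ A] exI[of _ r]) simp
  qed
  moreover have "k \<le> card (pverts T)" if P: "?P k" for k
  proof -
    from P obtain A where "subgraph (with_proj A) (with_proj T)" "k \<le> card (pverts A)" by blast
    then show ?thesis
      using card_mono[OF fin, of "pverts A"] by (simp add: subgraph_def)
  qed
  ultimately have "?P (f22 T)"
    unfolding f22_def by (rule GreatestI_nat)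
  then obtain A r where A: "subgraph (with_proj A) (with_proj T)" "arborescence A r"
      "path_monochromatic c A" "depth A \<le> 2" "f22 T \<le> card (pverts A)" by blast
  have sub: "pverts A \<subseteq> mono_reach T c r"
    using pverts_arborescence_subset_mono_reach[OF A(1-4)] .
  have "r \<in> pverts A" using A(2) by (simp add: arborescence_def)
  then have "r \<in> pverts T" using sub by (auto simp: mono_reach_def)
  have "card (pverts A) \<le> card (mono_reach T c r)"
    by (rule card_mono[OF _ sub]) (use fin in \<open>simp add: mono_reach_def\<close>)
  also have "\<dots> \<le> M" by (rule M) fact
  finally show ?thesis using A(5) by simp
qed

section \<open>Counting copies of a fixed tournament\<close>

text \<open>Labelled copies of \<open>H\<close>; extensionality off \<open>W\<close> leaves finitely
  many maps to count. Injectivity is automatic in a loopless \<open>T\<close> when \<open>H\<close>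
  joins any two points of \<open>W\<close>.\<close>

definition embeddings :: "('w \<Rightarrow> 'w \<Rightarrow> bool) \<Rightarrow> 'w set \<Rightarrow> 'a pair_pre_digraph \<Rightarrow> ('w \<Rightarrow> 'a) set" where
  "embeddings H W T = {\<phi> \<in> W \<rightarrow>\<^sub>E pverts T. \<forall>x\<in>W. \<forall>y\<in>W. H x y \<longrightarrow> (\<phi> x, \<phi> y) \<in> parcs T}"

lemma finite_embeddings: "finite W \<Longrightarrow> finite (pverts T) \<Longrightarrow> finite (embeddings H W T)"
  by (rule finite_subset[of _ "W \<rightarrow>\<^sub>E pverts T"]) (auto simp: embeddings_def intro: finite_PiE)

lemma embeddings_arc:
  "\<phi> \<in> embeddings H W T \<Longrightarrow> x \<in> W \<Longrightarrow> y \<in> W \<Longrightarrow> H x y \<Longrightarrow> (\<phi> x, \<phi> y) \<in> parcs T"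
  by (simp add: embeddings_def)

lemma inj_on_embedding:
  assumes "pair_digraph T" "\<phi> \<in> embeddings H W T"
    and total: "\<And>x y. x \<in> W \<Longrightarrow> y \<in> W \<Longrightarrow> x \<noteq> y \<Longrightarrow> H x y \<or> H y x"
  shows "inj_on \<phi> W"
proof (rule inj_onI, rule ccontr)
  fix x y assume xy: "x \<in> W" "y \<in> W" "\<phi> x = \<phi> y" "x \<noteq> y"
  then have "(\<phi> x, \<phi> x) \<in> parcs T"
    using total[of x y] embeddings_arc[OF assms(2), of x y] embeddings_arc[OF assms(2), of y x] by auto
  then show False
    using pair_loopfree_digraph.pair_no_loops[of T "(\<phi> x, \<phi> x)"] assms(1)
    by (simp add: pair_digraph_def)
qed

text \<open>\<open>H\<close> joins each point of \<open>W\<close> to \<open>w\<close>, so the arcs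
  between \<open>v\<close> and all images are prescribed. A value already used for another point
  would create a loop.\<close>

lemma embedding_extension_iff:
  assumes T: "pair_digraph T" and w: "w \<notin> W" "\<not> H w w" and \<phi>: "\<phi> \<in> embeddings H W T"
    and total: "\<And>x. x \<in> W \<Longrightarrow> H x w \<or> H w x"
  shows "\<phi>(w := v) \<in> embeddings H (insert w W) T \<longleftrightarrow>
    v \<in> common_nbrs T (pverts T - \<phi> ` W) (\<phi> ` {x \<in> W. H x w}) (\<phi> ` {x \<in> W. H w x})"
    (is "?L \<longleftrightarrow> ?R")
proof
  assume L: ?L
  have upd: "(\<phi>(w := v)) x = \<phi> x" if "x \<in> W" for x using that w by auto
  have arcs: "(x \<in> W \<longrightarrow> H x w \<longrightarrow> (\<phi> x, v) \<in> parcs T) \<and> (x \<in> W \<longrightarrow> H w x \<longrightarrow> (v, \<phi> x) \<in> parcs T)" for x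
    using w embeddings_arc[OF L, of x w] embeddings_arc[OF L, of w x] by (cases "x = w") auto
  have "v \<noteq> \<phi> x" if "x \<in> W" for x
    using arcs[of x] total[OF that] that
      pair_loopfree_digraph.pair_no_loops[of T "(v, v)"] T by (auto simp: pair_digraph_def)
  moreover have "v \<in> pverts T" using L by (auto simp: embeddings_def PiE_def Pi_def)
  ultimately show ?R using arcs by (auto simp: common_nbrs_def)
next
  assume R: ?R
  have "\<phi>(w := v) \<in> insert w W \<rightarrow>\<^sub>E pverts T"
    using R \<phi> by (intro PiE_fun_upd) (auto simp: embeddings_def common_nbrs_def)
  moreover have "((\<phi>(w := v)) x, (\<phi>(w := v)) y) \<in> parcs T"
    if "x \<in> insert w W" "y \<in> insert w W" "H x y" for x y
    using that R w embeddings_arc[OF \<phi>, of x y] by (auto simp: common_nbrs_def)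
  ultimately show ?L unfolding embeddings_def by blast
qed

text \<open>Group the embeddings of the larger set by their restriction to \<open>W\<close>. The
  predicate \<open>P\<close> ignores the value at \<open>w\<close>; later it prescribes the images
  of two points placed earlier.\<close>

lemma card_embeddings_insert:
  assumes T: "pair_digraph T" and W: "finite W" "w \<notin> W" "\<not> H w w"
    and total: "\<And>x. x \<in> W \<Longrightarrow> H x w \<or> H w x"
    and P: "\<And>\<phi> v. P (\<phi>(w := v)) = P \<phi>"
  shows "card {\<phi> \<in> embeddings H (insert w W) T. P \<phi>} =
    (\<Sum>\<phi> \<in> {\<phi> \<in> embeddings H W T. P \<phi>}.
      card (common_nbrs T (pverts T - \<phi> ` W) (\<phi> ` {x \<in> W. H x w}) (\<phi> ` {x \<in> W. H w x})))"
proof -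
  let ?F = "{\<phi> \<in> embeddings H W T. P \<phi>}"
  let ?ext = "\<lambda>\<phi>. common_nbrs T (pverts T - \<phi> ` W) (\<phi> ` {x \<in> W. H x w}) (\<phi> ` {x \<in> W. H w x})"
  interpret T: pair_digraph T by (rule T)
  have undef: "\<phi> w = undefined" if "\<phi> \<in> ?F" for \<phi>
    using that W by (auto simp: embeddings_def PiE_def extensional_def)
  have "bij_betw (\<lambda>(\<phi>, v). \<phi>(w := v)) (SIGMA \<phi>:?F. ?ext \<phi>) {\<phi> \<in> embeddings H (insert w W) T. P \<phi>}"
  proof (rule bij_betw_imageI)
    show "inj_on (\<lambda>(\<phi>, v). \<phi>(w := v)) (SIGMA \<phi>:?F. ?ext \<phi>)"
    proof (rule inj_onI, clarify)
      fix \<phi> v \<psi> v' assume *: "\<phi> \<in> embeddings H W T" "P \<phi>" "\<psi> \<in> embeddings H W T" "P \<psi>"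
        and eq: "\<phi>(w := v) = \<psi>(w := v')"
      have "\<phi> x = \<psi> x" for x
        using undef[of \<phi>] undef[of \<psi>] * fun_cong[OF eq, of x] by (cases "x = w") auto
      moreover have "v = v'" using fun_cong[OF eq, of w] by simp
      ultimately show "\<phi> = \<psi> \<and> v = v'" by auto
    qed
    show "(\<lambda>(\<phi>, v). \<phi>(w := v)) ` (SIGMA \<phi>:?F. ?ext \<phi>) = {\<phi> \<in> embeddings H (insert w W) T. P \<phi>}"
    proof
      show "(\<lambda>(\<phi>, v). \<phi>(w := v)) ` (SIGMA \<phi>:?F. ?ext \<phi>) \<subseteq> {\<phi> \<in> embeddings H (insert w W) T. P \<phi>}"
      proof safe
        fix \<phi> v assume \<phi>: "\<phi> \<in> embeddings H W T" "P \<phi>" and v: "v \<in> ?ext \<phi>"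
        show "\<phi>(w := v) \<in> embeddings H (insert w W) T"
          using embedding_extension_iff[where H = H, OF T W(2,3) \<phi>(1) total] v by blast
        show "P (\<phi>(w := v))" using \<phi>(2) P by blast
      qed
      show "{\<phi> \<in> embeddings H (insert w W) T. P \<phi>} \<subseteq> (\<lambda>(\<phi>, v). \<phi>(w := v)) ` (SIGMA \<phi>:?F. ?ext \<phi>)"
      proof
        fix \<psi> assume \<psi>: "\<psi> \<in> {\<phi> \<in> embeddings H (insert w W) T. P \<phi>}"
        define \<phi> where "\<phi> = \<psi>(w := undefined)"
        have eq: "\<psi> = \<phi>(w := \<psi> w)" by (simp add: \<phi>_def)
        have \<phi>: "\<phi> \<in> embeddings H W T"
          using \<psi> W by (auto simp: \<phi>_def embeddings_def PiE_def extensional_def Pi_def)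
        have "\<psi> w \<in> ?ext \<phi>"
          using embedding_extension_iff[where H = H, OF T W(2,3) \<phi> total, of "\<psi> w"] \<psi> eq by simp
        moreover have "P \<phi>" using \<psi> P by (simp add: \<phi>_def)
        ultimately have "(\<phi>, \<psi> w) \<in> (SIGMA \<phi>:?F. ?ext \<phi>)" using \<phi> by simp
        then show "\<psi> \<in> (\<lambda>(\<phi>, v). \<phi>(w := v)) ` (SIGMA \<phi>:?F. ?ext \<phi>)"
          using eq by (intro image_eqI[of _ _ "(\<phi>, \<psi> w)"]) auto
      qed
    qed
  qed
  then have "card {\<phi> \<in> embeddings H (insert w W) T. P \<phi>} = card (SIGMA \<phi>:?F. ?ext \<phi>)"
    by (simp add: bij_betw_same_card)
  also have "\<dots> = (\<Sum>\<phi>\<in>?F. card (?ext \<phi>))"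
    using finite_embeddings[OF W(1), of T H] T.pair_finite_verts
    by (intro card_SigmaI) (auto simp: common_nbrs_def)
  finally show ?thesis .
qed

text \<open>The number of ways to extend an embedding of \<open>k\<close> points by one more point
  lies between \<open>ext_lower\<close> and \<open>ext_upper\<close>. The \<open>max 0\<close> keeps
  the factors nonnegative, so that the inequalities can be multiplied.\<close>

definition ext_lower :: "nat \<Rightarrow> real \<Rightarrow> nat \<Rightarrow> real" where
  "ext_lower n t k = max 0 ((real n - real k) / 2 ^ k - t)"

definition ext_upper :: "nat \<Rightarrow> real \<Rightarrow> nat \<Rightarrow> real" where
  "ext_upper n t k = real n / 2 ^ k + t"

context
  fixes n :: nat and t :: real and T :: "nat pair_pre_digraph" and H :: "'w \<Rightarrow> 'w \<Rightarrow> bool" and W :: "'w set"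
  assumes T: "pair_digraph T" and V: "pverts T = {1..n}" and t: "t \<ge> 0"
    and qr: "quasirandom 8 (\<lambda>A B. {1..n} - (A \<union> B)) n t T"
    and H: "\<And>x. x \<in> W \<Longrightarrow> \<not> H x x" "\<And>x y. x \<in> W \<Longrightarrow> y \<in> W \<Longrightarrow> x \<noteq> y \<Longrightarrow> H x y \<noteq> H y x"
    and W: "finite W" "card W \<le> 9"
begin

text \<open>Every image point is a prescribed in- or out-neighbour, so quasirandomness applies with
  \<open>A \<union> B\<close> the image of \<open>U\<close>. This image has at most 8 points, as
  \<open>U\<close> lacks the point \<open>w\<close> of \<open>W\<close>.\<close>

lemma card_extensions:
  assumes \<phi>: "\<phi> \<in> embeddings H U T" and U: "U \<subseteq> W" "w \<in> W" "w \<notin> U"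
  shows "\<bar>real (card (common_nbrs T (pverts T - \<phi> ` U) (\<phi> ` {x \<in> U. H x w}) (\<phi> ` {x \<in> U. H w x})))
     - (real n - real (card U)) / 2 ^ card U\<bar> \<le> t"
proof -
  let ?A = "\<phi> ` {x \<in> U. H x w}" and ?B = "\<phi> ` {x \<in> U. H w x}"
  have inj: "inj_on \<phi> U"
    by (rule inj_on_embedding[OF T \<phi>]) (use H U in blast)
  have un: "?A \<union> ?B = \<phi> ` U"
    using H(2) U by blast
  have "finite U" using U W finite_subset by blast
  have "card U < card W" using U W by (intro psubset_card_mono) auto
  then have U8: "card U \<le> 8" using W by simp
  have disj: "?A \<inter> ?B = {}"
  proof (intro equals0I)
    fix a assume "a \<in> ?A \<inter> ?B"
    then obtain x y where xy: "x \<in> U" "H x w" "y \<in> U" "H w y" "\<phi> x = \<phi> y" by auto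
    then have "x = y" using inj_onD[OF inj] by blast
    then show False using xy H(2)[of x w] U by auto
  qed
  have sub: "\<phi> ` U \<subseteq> {1..n}"
    using \<phi> V by (auto simp: embeddings_def)
  have c: "card (\<phi> ` U) = card U" using inj by (rule card_image)
  have "card ({1..n} - \<phi> ` U) = n - card U"
    using sub c \<open>finite U\<close> by (simp add: card_Diff_subset)
  moreover have "card U \<le> n" using card_mono[OF _ sub] c by simp
  ultimately have "real (card ({1..n} - \<phi> ` U)) = real n - real (card U)" by simp
  then show ?thesis
    using qr[unfolded quasirandom_def, rule_format, of ?A ?B] disj sub U8 c by (simp add: un V)
qed

lemma card_embeddings_insert_bounds:
  assumes U: "U \<subseteq> W" "w \<in> W" "w \<notin> U" and P: "\<And>\<phi> v. P (\<phi>(w := v)) = P \<phi>"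
  shows "real (card {\<phi> \<in> embeddings H U T. P \<phi>}) * ext_lower n t (card U)
      \<le> real (card {\<phi> \<in> embeddings H (insert w U) T. P \<phi>})"
    and "real (card {\<phi> \<in> embeddings H (insert w U) T. P \<phi>})
      \<le> real (card {\<phi> \<in> embeddings H U T. P \<phi>}) * ext_upper n t (card U)"
proof -
  let ?F = "{\<phi> \<in> embeddings H U T. P \<phi>}"
  let ?e = "\<lambda>\<phi>. real (card (common_nbrs T (pverts T - \<phi> ` U) (\<phi> ` {x \<in> U. H x w}) (\<phi> ` {x \<in> U. H w x})))"
  have fin: "finite U" using U W finite_subset by blast
  have total: "H x w \<or> H w x" if "x \<in> U" for x
    using H(2)[of x w] U that by blast
  have eq: "real (card {\<phi> \<in> embeddings H (insert w U) T. P \<phi>}) = (\<Sum>\<phi>\<in>?F. ?e \<phi>)"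
    using card_embeddings_insert[where P = P and H = H, OF T fin U(3) H(1)[OF U(2)] total P] by simp
  have ext: "\<bar>?e \<phi> - (real n - real (card U)) / 2 ^ card U\<bar> \<le> t" if "\<phi> \<in> ?F" for \<phi>
    using card_extensions[OF _ U] that by blast
  have "ext_lower n t (card U) \<le> ?e \<phi>" if "\<phi> \<in> ?F" for \<phi>
    using ext[OF that] by (auto simp: ext_lower_def)
  then show "real (card ?F) * ext_lower n t (card U) \<le> real (card {\<phi> \<in> embeddings H (insert w U) T. P \<phi>})"
    unfolding eq by (rule sum_bounded_below)
  have "?e \<phi> \<le> ext_upper n t (card U)" if "\<phi> \<in> ?F" for \<phi>
  proof -
    have "(real n - real (card U)) / 2 ^ card U \<le> real n / 2 ^ card U"
      by (rule divide_right_mono) auto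
    then show ?thesis using ext[OF that] by (auto simp: ext_upper_def)
  qed
  then show "real (card {\<phi> \<in> embeddings H (insert w U) T. P \<phi>}) \<le> real (card ?F) * ext_upper n t (card U)"
    unfolding eq by (rule sum_bounded_above)
qed

text \<open>Place the points of \<open>W - W0\<close> one after the other; the point added to
  \<open>k\<close> present ones contributes the factor with index \<open>k\<close>.\<close>

lemma card_embeddings_bounds:
  assumes W0: "W0 \<subseteq> W" and P: "\<And>w \<phi> v. w \<in> W - W0 \<Longrightarrow> P (\<phi>(w := v)) = P \<phi>"
  shows "real (card {\<phi> \<in> embeddings H W0 T. P \<phi>}) * (\<Prod>k = card W0..<card W. ext_lower n t k)
      \<le> real (card {\<phi> \<in> embeddings H W T. P \<phi>})"
    and "real (card {\<phi> \<in> embeddings H W T. P \<phi>})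
      \<le> real (card {\<phi> \<in> embeddings H W0 T. P \<phi>}) * (\<Prod>k = card W0..<card W. ext_upper n t k)"
proof -
  let ?N = "\<lambda>U. real (card {\<phi> \<in> embeddings H U T. P \<phi>})"
  have fin0: "finite W0" using W0 W finite_subset by blast
  have "?N W0 * (\<Prod>k = card W0..<card (W0 \<union> D). ext_lower n t k) \<le> ?N (W0 \<union> D) \<and>
      ?N (W0 \<union> D) \<le> ?N W0 * (\<Prod>k = card W0..<card (W0 \<union> D). ext_upper n t k)"
    if "finite D" "D \<subseteq> W - W0" for D
    using that
  proof (induction D rule: finite_induct)
    case (insert w D)
    then have w: "W0 \<union> D \<subseteq> W" "w \<in> W" "w \<notin> W0 \<union> D" and wW0: "w \<in> W - W0" using W0 by auto
    note step = card_embeddings_insert_bounds[OF w P[OF wW0]]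
    have "card W0 \<le> card (W0 \<union> D)" using insert fin0 by (intro card_mono) auto
    then have prod: "(\<Prod>k = card W0..<card (insert w (W0 \<union> D)). f k)
        = (\<Prod>k = card W0..<card (W0 \<union> D). f k) * f (card (W0 \<union> D))" for f :: "nat \<Rightarrow> real"
      using w(3) insert fin0 by (simp add: prod.atLeastLessThan_Suc)
    have IH: "?N W0 * (\<Prod>k = card W0..<card (W0 \<union> D). ext_lower n t k) \<le> ?N (W0 \<union> D)"
        "?N (W0 \<union> D) \<le> ?N W0 * (\<Prod>k = card W0..<card (W0 \<union> D). ext_upper n t k)"
      using insert by auto
    have "0 \<le> ext_lower n t k" "0 \<le> ext_upper n t k" for k
      using t by (auto simp: ext_lower_def ext_upper_def)
    then show ?case
      using order_trans[OF mult_right_mono[OF IH(1)] step(1)]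
        order_trans[OF step(2) mult_right_mono[OF IH(2)]] prod
      by (simp add: mult.assoc)
  qed simp
  from this[of "W - W0"] W0 W
  show "?N W0 * (\<Prod>k = card W0..<card W. ext_lower n t k) \<le> ?N W"
    and "?N W \<le> ?N W0 * (\<Prod>k = card W0..<card W. ext_upper n t k)"
    by (simp_all add: Un_absorb1)
qed

text \<open>Start from the single embedding of the empty set.\<close>

lemma card_embeddings_le: "real (card (embeddings H W T)) \<le> (\<Prod>k < card W. ext_upper n t k)"
proof -
  have "embeddings H {} T = {\<lambda>_. undefined}" by (auto simp: embeddings_def)
  then show ?thesis
    using card_embeddings_bounds(2)[of "{}" "\<lambda>_. True"] by (simp add: atLeast0LessThan)
qed

text \<open>Start from the embedding of \<open>{a, b}\<close> onto the given arc; the factors begin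
  at index 2 because two points are already placed.\<close>

lemma card_embeddings_arc_ge:
  assumes ab: "a \<in> W" "b \<in> W" "H a b" and uv: "(u, v) \<in> parcs T"
  shows "(\<Prod>k = 2..<card W. ext_lower n t k) \<le> real (card {\<phi> \<in> embeddings H W T. \<phi> a = u \<and> \<phi> b = v})"
proof -
  interpret T: pair_digraph T by (rule T)
  have ne: "a \<noteq> b" using ab H(1) by auto
  have H': "\<not> H b a" "\<not> H a a" "\<not> H b b" using ab ne H by blast+
  define \<phi> where "\<phi> = (\<lambda>_. undefined)(a := u, b := v)"
  have "\<phi> \<in> embeddings H {a, b} T"
    using ne H' uv T.in_arcsD1[OF uv] T.in_arcsD2[OF uv]
    by (auto simp: embeddings_def \<phi>_def PiE_def extensional_def)
  then have "\<phi> \<in> {\<phi> \<in> embeddings H {a, b} T. \<phi> a = u \<and> \<phi> b = v}"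
    using ne by (simp add: \<phi>_def)
  then have "card {\<phi> \<in> embeddings H {a, b} T. \<phi> a = u \<and> \<phi> b = v} > 0"
    using finite_embeddings[of "{a, b}" T H] T.pair_finite_verts by (auto simp: card_gt_0_iff)
  then have "1 \<le> real (card {\<phi> \<in> embeddings H {a, b} T. \<phi> a = u \<and> \<phi> b = v})" by linarith
  moreover have "0 \<le> (\<Prod>k = 2..<card W. ext_lower n t k)"
    by (intro prod_nonneg) (simp add: ext_lower_def)
  ultimately have "(\<Prod>k = 2..<card W. ext_lower n t k)
      \<le> real (card {\<phi> \<in> embeddings H {a, b} T. \<phi> a = u \<and> \<phi> b = v}) * (\<Prod>k = 2..<card W. ext_lower n t k)"
    using mult_right_mono[of 1] by fastforce
  also have "\<dots> \<le> real (card {\<phi> \<in> embeddings H W T. \<phi> a = u \<and> \<phi> b = v})"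
  proof -
    have "((\<phi>(w := z)) a = u \<and> (\<phi>(w := z)) b = v) = (\<phi> a = u \<and> \<phi> b = v)"
      if "w \<in> W - {a, b}" for w \<phi> z
      using that by auto
    from card_embeddings_bounds(1)[where ?W0.0 = "{a, b}" and P = "\<lambda>\<phi>. \<phi> a = u \<and> \<phi> b = v", OF _ this]
    show ?thesis using ab ne by (simp add: numeral_2_eq_2)
  qed
  finally show ?thesis .
qed

end

section \<open>The oriented affine plane of order 3\<close>

text \<open>
  The number \<open>3 * x + y\<close> stands for the point \<open>(x, y)\<close>. The orientations of the lines come from a
  computer search; they make the case of two bad arcs on every line propositionally unsatisfiable.
\<close>
definition affine_lines :: "(nat \<times> nat \<times> nat) list" where
  "affine_lines = [(0, 6, 3), (1, 7, 4), (2, 8, 5), (0, 8, 4), (1, 5, 6), (2, 3, 7), (0, 7, 5),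
      (1, 8, 3), (2, 4, 6), (0, 2, 1), (3, 4, 5), (6, 7, 8)]"

definition affine_arcs :: "(nat \<times> nat) list" where
  "affine_arcs = concat (map (\<lambda>(i, j, k). [(i, j), (j, k), (k, i)]) affine_lines)"

lemma distinct_affine_arcs: "distinct affine_arcs"
  by (simp add: affine_arcs_def affine_lines_def)

lemma length_affine_arcs: "length affine_arcs = 36"
  by (simp add: affine_arcs_def affine_lines_def)

text \<open>Two points lie on exactly one line, whose cyclic orientation directs the pair once; the
  proof checks all pairs.\<close>

lemma affine_arcs_tournament:
  assumes "i < 9" "j < 9"
  shows "i \<noteq> j \<Longrightarrow> ((i, j) \<in> set affine_arcs) \<noteq> ((j, i) \<in> set affine_arcs)"
    and "(i, i) \<notin> set affine_arcs"
proof -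
  let ?V = "[0, 1, 2, 3, 4, 5, 6, 7, 8 :: nat]"
  have "list_all (\<lambda>i. (i, i) \<notin> set affine_arcs \<and>
      list_all (\<lambda>j. i \<noteq> j \<longrightarrow> ((i, j) \<in> set affine_arcs) \<noteq> ((j, i) \<in> set affine_arcs)) ?V) ?V"
    by (simp add: affine_arcs_def affine_lines_def)
  moreover have "i \<in> set ?V" "j \<in> set ?V" using assms by auto
  ultimately have "(i, i) \<notin> set affine_arcs \<and>
      (i \<noteq> j \<longrightarrow> ((i, j) \<in> set affine_arcs) \<noteq> ((j, i) \<in> set affine_arcs))"
    unfolding list_all_iff by blast
  then show "i \<noteq> j \<Longrightarrow> ((i, j) \<in> set affine_arcs) \<noteq> ((j, i) \<in> set affine_arcs)"
    and "(i, i) \<notin> set affine_arcs"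
    by blast+
qed

lemma affine_arcs_less_9: "(i, j) \<in> set affine_arcs \<Longrightarrow> i < 9 \<and> j < 9"
  by (auto simp: affine_arcs_def affine_lines_def)

text \<open>Each of the 12 lines is a cyclic triangle and carries at most two bad arcs, so 24 bad
  arcs force exactly two on every line. The colour conditions from the cyclic triangles exclude
  this.\<close>

lemma affine_arcs_bad_le:
  fixes S c :: "nat \<Rightarrow> nat \<Rightarrow> bool"
  assumes bad: "\<And>i j k. (i, j) \<in> set affine_arcs \<Longrightarrow> (j, k) \<in> set affine_arcs \<Longrightarrow>
    (k, i) \<in> set affine_arcs \<Longrightarrow> S i j \<Longrightarrow> c j k \<noteq> c k i"
  shows "(\<Sum>(i, j)\<leftarrow>affine_arcs. of_bool (S i j)) \<le> (23 :: nat)"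
proof (rule ccontr)
  define line :: "nat \<Rightarrow> nat \<Rightarrow> nat \<Rightarrow> nat" where
    "line i j k = of_bool (S i j) + of_bool (S j k) + of_bool (S k i)" for i j k
  define cyclic where "cyclic i j k \<longleftrightarrow> (i, j) \<in> set affine_arcs \<and> (j, k) \<in> set affine_arcs \<and>
    (k, i) \<in> set affine_arcs" for i j k
  have cyc: "(S i j \<longrightarrow> c j k \<noteq> c k i) \<and> (S j k \<longrightarrow> c k i \<noteq> c i j) \<and> (S k i \<longrightarrow> c i j \<noteq> c j k)"
    if "cyclic i j k" for i j k
    using that bad[of i j k] bad[of j k i] bad[of k i j] unfolding cyclic_def by blast
  \<comment> \<open>Three bad arcs would need three pairwise different colours out of two.\<close>
  have line_le: "line i j k \<le> 2" if "cyclic i j k" for i j k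
    using cyc[OF that] by (auto simp: line_def of_bool_def)
  have line_eq: "(S i j \<and> S j k \<and> \<not> S k i) \<or> (S i j \<and> \<not> S j k \<and> S k i) \<or> (\<not> S i j \<and> S j k \<and> S k i)"
    if "line i j k = 2" for i j k
    using that by (auto simp: line_def of_bool_def split: if_splits)
  have lines: "cyclic i j k" if "(i, j, k) \<in> set affine_lines" for i j k
    using that by (force simp: cyclic_def affine_arcs_def)
  have sum: "(\<Sum>(i, j)\<leftarrow>affine_arcs. of_bool (S i j)) = (\<Sum>(i, j, k)\<leftarrow>affine_lines. line i j k)"
    by (simp add: affine_arcs_def affine_lines_def line_def)
  assume "\<not> (\<Sum>(i, j)\<leftarrow>affine_arcs. of_bool (S i j)) \<le> (23 :: nat)"
  then have all: "24 \<le> line 0 6 3 + line 1 7 4 + line 2 8 5 + line 0 8 4 + line 1 5 6 +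
      line 2 3 7 + line 0 7 5 + line 1 8 3 + line 2 4 6 + line 0 2 1 + line 3 4 5 + line 6 7 8"
    unfolding sum by (simp add: affine_lines_def)
  have le: "list_all (\<lambda>(i, j, k). line i j k \<le> 2) affine_lines"
    using line_le lines by (auto simp: list_all_iff)
  \<comment> \<open>Twelve summands of at most 2 reach 24 only if all equal 2.\<close>
  have tight: "line 0 6 3 = 2" "line 1 7 4 = 2" "line 2 8 5 = 2" "line 0 8 4 = 2" "line 1 5 6 = 2"
      "line 2 3 7 = 2" "line 0 7 5 = 2" "line 1 8 3 = 2" "line 2 4 6 = 2" "line 0 2 1 = 2"
      "line 3 4 5 = 2" "line 6 7 8 = 2"
    using all le unfolding affine_lines_def list.pred_inject prod.case by linarith+
  \<comment> \<open>All 30 cyclic triangles of this regular tournament: the 12 lines and 18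
    others.\<close>
  let ?triangles = "[(0, 2, 1), (0, 6, 1), (0, 2, 3), (0, 2, 4), (0, 6, 3), (0, 8, 3), (0, 7, 4),
      (0, 8, 4), (0, 7, 5), (0, 8, 5), (1, 5, 2), (1, 7, 2), (1, 5, 3), (1, 8, 3), (1, 7, 4),
      (1, 8, 4), (1, 5, 6), (1, 8, 6), (2, 3, 7), (2, 4, 5), (2, 4, 6), (2, 8, 5), (2, 8, 6),
      (3, 4, 5), (3, 4, 6), (3, 7, 5), (3, 7, 8), (4, 6, 7), (5, 6, 7), (6, 7, 8)]"
  have "list_all (\<lambda>(i, j, k). cyclic i j k) ?triangles"
    by (simp add: cyclic_def affine_arcs_def affine_lines_def)
  then have "list_all (\<lambda>(i, j, k). (S i j \<longrightarrow> c j k \<noteq> c k i) \<and>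
      (S j k \<longrightarrow> c k i \<noteq> c i j) \<and> (S k i \<longrightarrow> c i j \<noteq> c j k)) ?triangles"
  proof (rule list.pred_mono_strong)
    fix z assume "case z of (i, j, k) \<Rightarrow> cyclic i j k"
    then show "case z of (i, j, k) \<Rightarrow> (S i j \<longrightarrow> c j k \<noteq> c k i) \<and>
      (S j k \<longrightarrow> c k i \<noteq> c i j) \<and> (S k i \<longrightarrow> c i j \<noteq> c j k)"
      using cyc by (cases z) (simp only: prod.case)
  qed
  \<comment> \<open>With \<open>S\<close> and \<open>c\<close> on the arcs as atoms, a finite
    propositional contradiction remains.\<close>
  then show False
    using tight[THEN line_eq] unfolding list.pred_inject prod.case
    by sat
qed

section \<open>The two bounds\<close>

definition bad_arcs :: "'a pair_pre_digraph \<Rightarrow> ('a \<times> 'a \<Rightarrow> bool) \<Rightarrow> ('a \<times> 'a) set" where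
  "bad_arcs T c = {(w, r) \<in> parcs T. w \<notin> mono_reach T c r}"

text \<open>Equal colours would let \<open>r\<close> reach \<open>w\<close> through
  \<open>x\<close>.\<close>

lemma bad_arc_triangle:
  assumes "pair_digraph T" "(w, r) \<in> bad_arcs T c" "(r, x) \<in> parcs T" "(x, w) \<in> parcs T"
  shows "c (r, x) \<noteq> c (x, w)"
proof -
  interpret T: pair_digraph T by fact
  have "w \<in> pverts T" using assms(4) by (rule T.in_arcsD2)
  then show ?thesis using assms by (auto simp: bad_arcs_def mono_reach_def)
qed

text \<open>Double count the pairs of an embedding and one of the 36 arcs whose image is bad. In
  each role a bad arc is hit by at least the lower product of embeddings, while every embedding has
  at most 23 bad images.\<close>

lemma bad_arcs_bound:
  assumes T: "pair_digraph T" "pverts T = {1..n}" and t: "t \<ge> 0"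
    and qr: "quasirandom 8 (\<lambda>A B. {1..n} - (A \<union> B)) n t T"
  shows "36 * real (card (bad_arcs T c)) * (\<Prod>k = 2..<9. ext_lower n t k) \<le> 23 * (\<Prod>k<9. ext_upper n t k)"
proof -
  define H :: "nat \<Rightarrow> nat \<Rightarrow> bool" where "H i j \<longleftrightarrow> (i, j) \<in> set affine_arcs" for i j
  let ?W = "{..<9 :: nat}"
  let ?B = "bad_arcs T c"
  let ?E = "embeddings H ?W T"
  interpret T: pair_digraph T by (rule T)
  have H: "\<not> H x x" if "x \<in> ?W" for x
    using affine_arcs_tournament(2)[of x x] that by (simp add: H_def)
  have H': "H x y \<noteq> H y x" if "x \<in> ?W" "y \<in> ?W" "x \<noteq> y" for x y
    using affine_arcs_tournament(1)[of x y] that by (simp add: H_def)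
  have W: "finite ?W" "card ?W \<le> 9" by auto
  have finB: "finite ?B"
    using T.pair_finite_arcs by (rule finite_subset[rotated]) (auto simp: bad_arcs_def)
  have finE: "finite ?E" using W(1) T.pair_finite_verts by (rule finite_embeddings)
  have lower: "real (card ?B) * (\<Prod>k = 2..<9. ext_lower n t k)
      \<le> real (card {\<phi> \<in> ?E. (\<phi> i, \<phi> j) \<in> ?B})" if ij: "(i, j) \<in> set affine_arcs" for i j
  proof -
    have "real (card ?B) * (\<Prod>k = 2..<9. ext_lower n t k)
        = (\<Sum>e\<in>?B. \<Prod>k = 2..<9. ext_lower n t k)" by simp
    also have "\<dots> \<le> (\<Sum>e\<in>?B. real (card {\<phi> \<in> ?E. \<phi> i = fst e \<and> \<phi> j = snd e}))"
    proof (rule sum_mono)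
      fix e assume "e \<in> ?B"
      then have "(fst e, snd e) \<in> parcs T" by (auto simp: bad_arcs_def)
      then show "(\<Prod>k = 2..<9. ext_lower n t k) \<le> real (card {\<phi> \<in> ?E. \<phi> i = fst e \<and> \<phi> j = snd e})"
        using card_embeddings_arc_ge[where H = H, OF T t qr H H' W, where a = i and b = j] affine_arcs_less_9[OF ij] ij
        by (simp add: H_def)
    qed
    also have "\<dots> = real (\<Sum>e\<in>?B. card {\<phi> \<in> ?E. \<phi> i = fst e \<and> \<phi> j = snd e})" by simp
    also have "(\<Sum>e\<in>?B. card {\<phi> \<in> ?E. \<phi> i = fst e \<and> \<phi> j = snd e})
        = card (\<Union>e\<in>?B. {\<phi> \<in> ?E. \<phi> i = fst e \<and> \<phi> j = snd e})"
      using finB finE by (subst card_UN_disjoint) (auto simp: prod_eq_iff)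
    also have "(\<Union>e\<in>?B. {\<phi> \<in> ?E. \<phi> i = fst e \<and> \<phi> j = snd e}) = {\<phi> \<in> ?E. (\<phi> i, \<phi> j) \<in> ?B}"
      by force
    finally show ?thesis .
  qed
  have few: "(\<Sum>f\<in>set affine_arcs. of_bool ((\<phi> (fst f), \<phi> (snd f)) \<in> ?B)) \<le> (23 :: nat)"
    if \<phi>: "\<phi> \<in> ?E" for \<phi>
  proof -
    have arc: "(\<phi> i, \<phi> j) \<in> parcs T" if "(i, j) \<in> set affine_arcs" for i j
      using embeddings_arc[OF \<phi>, of i j] that affine_arcs_less_9[OF that] by (simp add: H_def)
    have "(\<Sum>(i, j)\<leftarrow>affine_arcs. of_bool ((\<phi> i, \<phi> j) \<in> ?B)) \<le> (23 :: nat)"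
    \<comment> \<open>The colouring is pulled back along \<open>\<phi>\<close>, which maps cyclic
      triangles to cyclic triangles of \<open>T\<close>.\<close>
    proof (rule affine_arcs_bad_le[where c = "\<lambda>i j. c (\<phi> i, \<phi> j)"])
      fix i j k assume "(i, j) \<in> set affine_arcs" "(j, k) \<in> set affine_arcs"
        "(k, i) \<in> set affine_arcs" "(\<phi> i, \<phi> j) \<in> ?B"
      then show "c (\<phi> j, \<phi> k) \<noteq> c (\<phi> k, \<phi> i)"
        using bad_arc_triangle[OF T(1), of "\<phi> i" "\<phi> j" c "\<phi> k"] arc by blast
    qed
    then show ?thesis
      by (simp add: sum_list_distinct_conv_sum_set[OF distinct_affine_arcs] case_prod_beta)
  qed
  have "36 * (real (card ?B) * (\<Prod>k = 2..<9. ext_lower n t k))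
      = (\<Sum>f\<in>set affine_arcs. real (card ?B) * (\<Prod>k = 2..<9. ext_lower n t k))"
    using distinct_card[OF distinct_affine_arcs] length_affine_arcs by simp
  also have "\<dots> \<le> (\<Sum>f\<in>set affine_arcs. real (card {\<phi> \<in> ?E. (\<phi> (fst f), \<phi> (snd f)) \<in> ?B}))"
    by (rule sum_mono) (use lower in auto)
  also have "\<dots> = (\<Sum>f\<in>set affine_arcs. \<Sum>\<phi>\<in>?E. of_bool ((\<phi> (fst f), \<phi> (snd f)) \<in> ?B))"
    using finE by (simp add: Int_def conj_commute)
  also have "\<dots> = (\<Sum>\<phi>\<in>?E. real (\<Sum>f\<in>set affine_arcs. of_bool ((\<phi> (fst f), \<phi> (snd f)) \<in> ?B)))"
    by (subst sum.swap) simp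
  also have "\<dots> \<le> (\<Sum>\<phi>\<in>?E. 23)"
  proof (rule sum_mono)
    fix \<phi> assume "\<phi> \<in> ?E"
    from of_nat_mono[OF few[OF this], where 'a = real]
    show "real (\<Sum>f\<in>set affine_arcs. of_bool ((\<phi> (fst f), \<phi> (snd f)) \<in> ?B)) \<le> 23" by simp
  qed
  also have "\<dots> = 23 * real (card ?E)" by simp
  also have "\<dots> \<le> 23 * (\<Prod>k<9. ext_upper n t k)"
    using card_embeddings_le[where H = H, OF T t qr H H' W] by simp
  finally show ?thesis by simp
qed

text \<open>A vertex missed by \<open>r\<close> is neither \<open>r\<close> nor an out-neighbour,
  hence in a tournament an in-neighbour; pairs of a root and a missed vertex are the reversed bad
  arcs.\<close>

lemma card_bad_arcs:
  assumes T: "tournament T"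
  shows "card (bad_arcs T c) = (\<Sum>r\<in>pverts T. card (pverts T - mono_reach T c r))"
proof -
  interpret T: pair_digraph T using T by (simp add: tournament_def)
  have "bad_arcs T c = prod.swap ` (SIGMA r:pverts T. pverts T - mono_reach T c r)"
  proof (intro set_eqI iffI)
    fix e assume e: "e \<in> bad_arcs T c"
    obtain w r where wr: "e = (w, r)" by fastforce
    then have "(w, r) \<in> parcs T" "w \<notin> mono_reach T c r" using e by (auto simp: bad_arcs_def)
    then have "(r, w) \<in> (SIGMA r:pverts T. pverts T - mono_reach T c r)"
      using T.in_arcsD1 T.in_arcsD2 by auto
    then show "e \<in> prod.swap ` (SIGMA r:pverts T. pverts T - mono_reach T c r)"
      unfolding wr by (rule image_eqI[rotated]) simp
  next
    fix e assume "e \<in> prod.swap ` (SIGMA r:pverts T. pverts T - mono_reach T c r)"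
    then obtain w r where e: "e = (w, r)" "r \<in> pverts T" "w \<in> pverts T" "w \<notin> mono_reach T c r" by auto
    then have "w \<noteq> r" "(r, w) \<notin> parcs T" by (auto simp: mono_reach_def)
    then have "(w, r) \<in> parcs T" using T e unfolding tournament_def by blast
    then show "e \<in> bad_arcs T c" using e by (simp add: bad_arcs_def)
  qed
  then have "card (bad_arcs T c) = card (SIGMA r:pverts T. pverts T - mono_reach T c r)"
    by (simp add: card_image)
  then show ?thesis using T.pair_finite_verts by simp
qed

text \<open>\<open>bad_arcs_bound\<close> divided by \<open>n\<close> bounds the average number of
  vertices that a root misses; this average is subtracted from \<open>n\<close>.\<close>

definition lower_bound :: "nat \<Rightarrow> real" where
  "lower_bound n = real n - 23 * (\<Prod>k<9. ext_upper n (real n powr (3 / 4)) k) /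
     (36 * (\<Prod>k = 2..<9. ext_lower n (real n powr (3 / 4)) k) * real n)"

text \<open>If every root missed more than the average allowed by \<open>bad_arcs_bound\<close>,
  summing over the roots would give too many bad arcs.\<close>

lemma f22_lower_bound:
  assumes T: "tournament T" "pverts T = {1..n}" and n: "n > 0"
    and qr: "quasirandom 8 (\<lambda>A B. {1..n} - (A \<union> B)) n (real n powr (3 / 4)) T"
    and pos: "(\<Prod>k = 2..<9. ext_lower n (real n powr (3 / 4)) k) > 0"
  shows "lower_bound n \<le> real (f22 T)"
proof -
  let ?t = "real n powr (3 / 4)"
  let ?L = "\<Prod>k = 2..<9. ext_lower n ?t k" and ?U = "\<Prod>k<9. ext_upper n ?t k"
  \<comment> \<open>Rounding up loses nothing: a natural number below \<open>?m\<close> is below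
    \<open>lower_bound n\<close>. A negative bound becomes 0.\<close>
  let ?m = "nat \<lceil>lower_bound n\<rceil>"
  interpret T: pair_digraph T using T by (simp add: tournament_def)
  have "?m \<le> f22 T"
  proof (rule f22_ge)
    fix c :: "nat \<times> nat \<Rightarrow> bool"
    show "\<exists>r\<in>pverts T. ?m \<le> card (mono_reach T c r)"
    proof (rule ccontr)
      assume neg: "\<not> (\<exists>r\<in>pverts T. ?m \<le> card (mono_reach T c r))"
      have less: "card (mono_reach T c r) < ?m" if "r \<in> pverts T" for r
      proof -
        have "\<not> ?m \<le> card (mono_reach T c r)" using neg that by blast
        then show ?thesis unfolding not_le .
      qed
      have "real n - lower_bound n < real (card (pverts T - mono_reach T c r))" if r: "r \<in> pverts T" for r
      proof -
        have sub: "mono_reach T c r \<subseteq> pverts T" by (auto simp: mono_reach_def)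
        have "card (pverts T - mono_reach T c r) = card (pverts T) - card (mono_reach T c r)"
          using sub T.pair_finite_verts by (intro card_Diff_subset) (auto intro: finite_subset)
        moreover have "card (mono_reach T c r) \<le> card (pverts T)"
          using sub T.pair_finite_verts by (rule card_mono[rotated])
        ultimately have "real (card (pverts T - mono_reach T c r)) = real n - real (card (mono_reach T c r))"
          using T(2) by simp
        moreover have "real (card (mono_reach T c r)) < lower_bound n"
          using less[OF r] by linarith
        ultimately show ?thesis by linarith
      qed
      then have "(\<Sum>r\<in>pverts T. real n - lower_bound n) < (\<Sum>r\<in>pverts T. real (card (pverts T - mono_reach T c r)))"
        using T.pair_finite_verts T(2) n by (intro sum_strict_mono) auto
      then have "real n * (real n - lower_bound n) < real (card (bad_arcs T c))"
        using T(2) by (simp add: card_bad_arcs[OF T(1)])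
      then have "23 * ?U / (36 * ?L) < real (card (bad_arcs T c))"
        using n by (simp add: lower_bound_def)
      then have "23 * ?U < 36 * real (card (bad_arcs T c)) * ?L"
        using pos by (simp add: field_simps)
      moreover have "36 * real (card (bad_arcs T c)) * ?L \<le> 23 * ?U"
        by (rule bad_arcs_bound[OF _ T(2) _ qr]) (simp_all add: T.pair_digraph_axioms)
      ultimately show False by linarith
    qed
  qed (rule T.pair_digraph_axioms)
  then show ?thesis by linarith
qed

lemma ext_bounds_asymp:
  shows "(\<lambda>n. ext_upper n (real n powr (3 / 4)) k / real n) \<longlonglongrightarrow> 1 / 2 ^ k"
    and "(\<lambda>n. ext_lower n (real n powr (3 / 4)) k / real n) \<longlonglongrightarrow> 1 / 2 ^ k"
proof -
  have pow: "(2 :: real) ^ k > 0" by simp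
  have "(\<lambda>n. ext_upper n (real n powr (3 / 4)) k / real n) \<longlonglongrightarrow> inverse (2 ^ k)"
    unfolding ext_upper_def using pow by real_asymp
  then show "(\<lambda>n. ext_upper n (real n powr (3 / 4)) k / real n) \<longlonglongrightarrow> 1 / 2 ^ k"
    by (simp add: inverse_eq_divide)
  have "(\<lambda>n. ((real n - real k) / 2 ^ k - real n powr (3 / 4)) / real n) \<longlonglongrightarrow> inverse (2 ^ k)"
    using pow by real_asymp
  from tendsto_max[OF tendsto_const[of 0] this]
  have "(\<lambda>n. max 0 (((real n - real k) / 2 ^ k - real n powr (3 / 4)) / real n)) \<longlonglongrightarrow> inverse (2 ^ k)"
    by simp
  moreover have "max 0 (x / real n) = max 0 x / real n" for x n
    by (simp add: max_def divide_le_0_iff)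
      (auto simp: zero_le_divide_iff)
  ultimately show "(\<lambda>n. ext_lower n (real n powr (3 / 4)) k / real n) \<longlonglongrightarrow> 1 / 2 ^ k"
    by (simp add: ext_lower_def inverse_eq_divide)
qed

text \<open>The upper product has limit factors for \<open>k\<close> from 0 to 8, the lower one for
  \<open>k\<close> from 2 to 8, so their normalised quotient tends to \<open>1 * (1 / 2)\<close>.
  Hence the limit is \<open>1 - 23 / 72 = 49 / 72\<close>.\<close>

lemma lower_bound_asymp:
  "(\<lambda>n. lower_bound n / real n) \<longlonglongrightarrow> 49 / 72"
  "eventually (\<lambda>n. (\<Prod>k = 2..<9. ext_lower n (real n powr (3 / 4)) k) > 0) sequentially"
proof -
  let ?l = "\<lambda>n. \<Prod>k = 2..<9. ext_lower n (real n powr (3 / 4)) k / real n"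
  let ?u = "\<lambda>n. \<Prod>k<9. ext_upper n (real n powr (3 / 4)) k / real n"
  have l: "?l \<longlonglongrightarrow> (\<Prod>k = 2..<9. 1 / 2 ^ k)" by (intro tendsto_prod ext_bounds_asymp)
  have u: "?u \<longlonglongrightarrow> (\<Prod>k<9. 1 / 2 ^ k)" by (intro tendsto_prod ext_bounds_asymp)
  have upper: "(\<Prod>k<9. 1 / 2 ^ k :: real) = 1 / 2 * (\<Prod>k = 2..<9. 1 / 2 ^ k)"
    by (simp add: lessThan_Suc eval_nat_numeral)
  have pos: "(\<Prod>k = 2..<9. 1 / 2 ^ k :: real) > 0" by (intro prod_pos) simp
  have ev: "eventually (\<lambda>n. ?l n > 0) sequentially" by (rule order_tendstoD(1)[OF l pos])
  then show "eventually (\<lambda>n. (\<Prod>k = 2..<9. ext_lower n (real n powr (3 / 4)) k) > 0) sequentially"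
  proof (eventually_elim)
    case (elim n)
    then show ?case
      by (simp add: prod_dividef zero_less_divide_iff split: if_splits)
  qed
  have "(\<lambda>n. 1 - 23 * ?u n / (36 * ?l n)) \<longlonglongrightarrow> 1 - 23 * (\<Prod>k<9. 1 / 2 ^ k) / (36 * (\<Prod>k = 2..<9. 1 / 2 ^ k))"
    using pos by (intro tendsto_intros u l) auto
  also have "1 - 23 * (\<Prod>k<9. 1 / 2 ^ k) / (36 * (\<Prod>k = 2..<9. 1 / 2 ^ k)) = (49 / 72 :: real)"
    unfolding upper using pos by (simp add: field_simps)
  finally show "(\<lambda>n. lower_bound n / real n) \<longlonglongrightarrow> 49 / 72"
  proof (rule Lim_transform_eventually)
    show "eventually (\<lambda>n. 1 - 23 * ?u n / (36 * ?l n) = lower_bound n / real n) sequentially"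
      using eventually_gt_at_top[of 0]
    proof eventually_elim
      case (elim n)
      have "?l n = (\<Prod>k = 2..<9. ext_lower n (real n powr (3 / 4)) k) / real n ^ 7"
        "?u n = (\<Prod>k<9. ext_upper n (real n powr (3 / 4)) k) / real n ^ 9"
        by (simp_all add: prod_dividef)
      \<comment> \<open>Nine upper factors stand against seven lower ones and two divisions by
        \<open>n\<close>, so the powers of \<open>n\<close> cancel; for \<open>l = 0\<close> both
        sides are 0.\<close>
      moreover have "23 * (u / x ^ 9) / (36 * (l / x ^ 7)) = 23 * u / (36 * l * x) / x"
        if "x > 0" for u l x :: real
        using that by (cases "l = 0") (simp_all add: divide_simps power_numeral_reduce)
      ultimately have "23 * ?u n / (36 * ?l n) = 23 * (\<Prod>k<9. ext_upper n (real n powr (3 / 4)) k) /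
          (36 * (\<Prod>k = 2..<9. ext_lower n (real n powr (3 / 4)) k) * real n) / real n"
        using elim by (simp only: of_nat_0_less_iff)
      then show ?case
        using elim by (simp add: lower_bound_def diff_divide_distrib)
    qed
  qed
qed

section \<open>The bisection colouring\<close>

text \<open>The arguments follow the shape of a test set in \<open>quasirandom\<close>; for
  \<open>A = {r}\<close> and \<open>B = {}\<close> it is the half without \<open>r\<close>.\<close>

definition opposite_half :: "nat \<Rightarrow> nat set \<Rightarrow> nat set \<Rightarrow> nat set" where
  "opposite_half n A B = {x \<in> {1..n} - (A \<union> B). \<forall>a\<in>A. (x \<le> n div 2) \<noteq> (a \<le> n div 2)}"

text \<open>If the half of \<open>r\<close> has \<open>s\<close> vertices, \<open>r\<close> reaches
  at most \<open>s + (n - s) / 2 + t\<close>; with \<open>s \<le> (n + 1) / 2\<close> this is at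
  most \<open>3 / 4 * n + 1 / 4 + t\<close>.\<close>

lemma f22_upper_bound:
  assumes T: "pair_digraph T" "pverts T = {1..n}" and n: "n > 0" and t: "t \<ge> 0"
    and qr: "quasirandom 8 (opposite_half n) n t T"
  shows "real (f22 T) \<le> 3 / 4 * real n + 1 + t"
proof -
  let ?c = "\<lambda>(u, v). (u \<le> n div 2) = (v \<le> n div 2)"
  let ?M = "nat \<lfloor>3 / 4 * real n + 1 + t\<rfloor>"
  have "f22 T \<le> ?M"
  proof (rule f22_le[where c = ?c])
    fix r assume "r \<in> pverts T"
    then have r: "r \<in> {1..n}" using T(2) by simp
    let ?S = "{x \<in> {1..n}. (x \<le> n div 2) = (r \<le> n div 2)}"
    let ?X = "opposite_half n {r} {}"
    have X: "?X = {1..n} - ?S" by (auto simp: opposite_half_def)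
    \<comment> \<open>Two arcs of one colour starting at \<open>r\<close> both stay in its half or
      both cross, so they end in that half; the other half is reached by single arcs only.\<close>
    have "mono_reach T ?c r \<subseteq> ?S \<union> common_nbrs T ?X {r} {}"
      using T(2) by (auto simp: mono_reach_def common_nbrs_def X)
    then have "card (mono_reach T ?c r) \<le> card (?S \<union> common_nbrs T ?X {r} {})"
      by (rule card_mono[rotated]) (simp add: common_nbrs_def X)
    also have "\<dots> \<le> card ?S + card (common_nbrs T ?X {r} {})" by (rule card_Un_le)
    finally have 1: "real (card (mono_reach T ?c r)) \<le> real (card ?S) + real (card (common_nbrs T ?X {r} {}))"
      by linarith
    have "\<bar>real (card (common_nbrs T ?X {r} {})) - real (card ?X) / 2 ^ card ({r} \<union> {})\<bar> \<le> t"
      using qr[unfolded quasirandom_def, rule_format, of "{r}" "{}"] r by simp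
    then have 2: "real (card (common_nbrs T ?X {r} {})) \<le> real (card ?X) / 2 + t" by simp
    have S: "2 * card ?S \<le> n + 1"
    proof (cases "r \<le> n div 2")
      case True
      then have "?S = {1..n div 2}" by auto
      then show ?thesis by simp
    next
      case False
      then have "?S = {n div 2<..n}" by auto
      then show ?thesis by simp
    qed
    have "card ?X = n - card ?S"
      unfolding X by (subst card_Diff_subset) auto
    moreover have "card ?S \<le> card {1..n}" by (rule card_mono) auto
    ultimately have 3: "real (card ?X) = real n - real (card ?S)" by simp
    have "real (card (mono_reach T ?c r)) \<le> 3 / 4 * real n + 1 + t"
      using 1 2 3 S by linarith
    then show "card (mono_reach T ?c r) \<le> ?M" by linarith
  qed (use T n in auto)
  then show ?thesis using t by linarith
qed

section \<open>Passage to the random tournament\<close>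

text \<open>The inclusion of events is asked only on the support, so that facts about tournaments on
  \<open>{1..n}\<close> can be used.\<close>

lemma whp_mono:
  assumes "(\<lambda>n. measure_pmf.prob (p n) (A n)) \<longlonglongrightarrow> 1"
    and "eventually (\<lambda>n. \<forall>x\<in>set_pmf (p n). x \<in> A n \<longrightarrow> x \<in> B n) sequentially"
  shows "(\<lambda>n. measure_pmf.prob (p n) (B n)) \<longlonglongrightarrow> 1"
proof (rule tendsto_sandwich)
  show "(\<lambda>n. measure_pmf.prob (p n) (A n)) \<longlonglongrightarrow> 1" by (rule assms(1))
  show "(\<lambda>_. 1 :: real) \<longlonglongrightarrow> 1" by (rule tendsto_const)
  show "eventually (\<lambda>n. measure_pmf.prob (p n) (A n) \<le> measure_pmf.prob (p n) (B n)) sequentially"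
    using assms(2)
  proof eventually_elim
    case (elim n)
    then show ?case by (intro measure_pmf.finite_measure_mono_AE) (simp_all add: AE_measure_pmf_iff)
  qed
qed simp

lemma random_tournament_props:
  assumes "T \<in> set_pmf (random_tournament n)"
  shows "tournament T" "pair_digraph T" "pverts T = {1..n}"
proof -
  show T: "tournament T" using assms by (rule tournament_random_tournament)
  then show "pair_digraph T" by (simp add: tournament_def)
  obtain b where "T = orient n b" using assms unfolding random_tournament_def set_map_pmf by blast
  then show "pverts T = {1..n}" by (simp add: orient_def)
qed

theorem theorem3:
  shows "(\<exists>\<epsilon> :: nat \<Rightarrow> real. \<epsilon> \<in> o(\<lambda>n. real n) \<and>
            (\<lambda>n. measure_pmf.prob (random_tournament n)
                   {T. real (f22 T) + \<epsilon> n \<ge> 49 / 72 * real n}) \<longlonglongrightarrow> 1)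
       \<and> (\<exists>\<epsilon> :: nat \<Rightarrow> real. \<epsilon> \<in> o(\<lambda>n. real n) \<and>
            (\<lambda>n. measure_pmf.prob (random_tournament n)
                   {T. real (f22 T) - \<epsilon> n \<le> 3 / 4 * real n}) \<longlonglongrightarrow> 1)"
proof
  \<comment> \<open>With exactly this gap as error, the event reads
    \<open>lower_bound n \<le> f22 T\<close>.\<close>
  let ?\<epsilon> = "\<lambda>n. 49 / 72 * real n - lower_bound n"
  have "(\<lambda>n. 49 / 72 - lower_bound n / real n) \<longlonglongrightarrow> 49 / 72 - 49 / 72"
    by (intro tendsto_intros lower_bound_asymp)
  moreover have "eventually (\<lambda>n. 49 / 72 - lower_bound n / real n = ?\<epsilon> n / real n) sequentially"
    using eventually_gt_at_top[of 0] by eventually_elim (simp add: field_simps)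
  ultimately have "(\<lambda>n. ?\<epsilon> n / real n) \<longlonglongrightarrow> 0"
    using Lim_transform_eventually by fastforce
  then have "?\<epsilon> \<in> o(\<lambda>n. real n)"
    using eventually_gt_at_top[of 0] by (intro smalloI_tendsto) (auto elim: eventually_mono)
  moreover have "(\<lambda>n. measure_pmf.prob (random_tournament n)
      {T. real (f22 T) + ?\<epsilon> n \<ge> 49 / 72 * real n}) \<longlonglongrightarrow> 1"
  proof (rule whp_mono[OF quasirandom_whp])
    show "eventually (\<lambda>n. \<forall>T\<in>set_pmf (random_tournament n).
        T \<in> {T. quasirandom 8 (\<lambda>A B. {1..n} - (A \<union> B)) n (real n powr (3 / 4)) T} \<longrightarrow>
        T \<in> {T. real (f22 T) + ?\<epsilon> n \<ge> 49 / 72 * real n}) sequentially"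
      using lower_bound_asymp(2) eventually_gt_at_top[of 0]
    proof eventually_elim
      case (elim n)
      show ?case
      proof (intro ballI impI)
        fix T assume T: "T \<in> set_pmf (random_tournament n)"
          "T \<in> {T. quasirandom 8 (\<lambda>A B. {1..n} - (A \<union> B)) n (real n powr (3 / 4)) T}"
        have "lower_bound n \<le> real (f22 T)"
          using f22_lower_bound[of T n] random_tournament_props[OF T(1)] T(2) elim by simp
        then show "T \<in> {T. real (f22 T) + ?\<epsilon> n \<ge> 49 / 72 * real n}" by simp
      qed
    qed
  qed simp
  ultimately show "\<exists>\<epsilon> :: nat \<Rightarrow> real. \<epsilon> \<in> o(\<lambda>n. real n) \<and>
      (\<lambda>n. measure_pmf.prob (random_tournament n)
        {T. real (f22 T) + \<epsilon> n \<ge> 49 / 72 * real n}) \<longlonglongrightarrow> 1"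
    by (intro exI[of _ ?\<epsilon>] conjI)
next
  \<comment> \<open>The error term of \<open>f22_upper_bound\<close> at
    \<open>t = n powr (3 / 4)\<close>.\<close>
  let ?\<epsilon> = "\<lambda>n. 1 + real n powr (3 / 4)"
  have "?\<epsilon> \<in> o(\<lambda>n. real n)" by real_asymp
  moreover have "(\<lambda>n. measure_pmf.prob (random_tournament n)
      {T. real (f22 T) - ?\<epsilon> n \<le> 3 / 4 * real n}) \<longlonglongrightarrow> 1"
  proof (rule whp_mono[OF quasirandom_whp])
    show "eventually (\<lambda>n. \<forall>T\<in>set_pmf (random_tournament n).
        T \<in> {T. quasirandom 8 (opposite_half n) n (real n powr (3 / 4)) T} \<longrightarrow>
        T \<in> {T. real (f22 T) - ?\<epsilon> n \<le> 3 / 4 * real n}) sequentially"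
      using eventually_gt_at_top[of 0]
    proof eventually_elim
      case (elim n)
      show ?case
      proof (intro ballI impI)
        fix T assume T: "T \<in> set_pmf (random_tournament n)"
          "T \<in> {T. quasirandom 8 (opposite_half n) n (real n powr (3 / 4)) T}"
        have "real (f22 T) \<le> 3 / 4 * real n + 1 + real n powr (3 / 4)"
          using f22_upper_bound[of T n] random_tournament_props[OF T(1)] T(2) elim by simp
        then show "T \<in> {T. real (f22 T) - ?\<epsilon> n \<le> 3 / 4 * real n}" by simp
      qed
    qed
  qed (auto simp: opposite_half_def)
  ultimately show "\<exists>\<epsilon> :: nat \<Rightarrow> real. \<epsilon> \<in> o(\<lambda>n. real n) \<and>
      (\<lambda>n. measure_pmf.prob (random_tournament n)
        {T. real (f22 T) - \<epsilon> n \<le> 3 / 4 * real n}) \<longlonglongrightarrow> 1"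
    by (intro exI[of _ ?\<epsilon>] conjI)
qed

end
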